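(* Let $S_I,S_{II},S_{III}$ denote the Stieltjes transforms of the probability measures of associated Jacobi polynomials with real parameters $a,b,c$ in Models I, II, III respectively, i.e. of the spectral measures of the Jacobi matrices $J_I,J_{II},J_{III}$. Then the following hold: $$S_{I}(z)=-\frac{{}_2F_1(c+1,c+a+1;2c+a+b+2;1/z)}{z\;{}_2F_1(c,c+a;2c+a+b;1/z)},$$ $$S_{II}(z)=-\frac{{}_2F_1(c+1,c+a+1;2c+a+b+2;1/z)}{z\;{}_2F_1(c,c+a+1;2c+a+b+1;1/z)},$$ $$S_{III}(z)=-\frac{{}_2F_1(c+1,c+a+1;2c+a+b+2;1/z)}{z\;{}_2F_1(c,c+a+1;2c+a+b+2;1/z)}.$$
   Context: ${}_2F_1$ is the Gauss hypergeometric function. Put $$\hat\lambda_0=\frac{c+a+1}{2c+a+b+2},\quad \lambda_n=\frac{n+c+a+1}{2n+2c+a+b+2}\cdot\frac{n+c+a+b+1}{2n+2c+a+b+1},\quad \mu_n=\frac{n+c}{2n+2c+a+b+1}\cdot\frac{n+c+b}{2n+2c+a+b}\quad(n\ge0).$$ All three matrices are infinite, symmetric and tridiagonal. Model I: $J_I$ has diagonal entries $\lambda_n+\mu_n$ ($n\ge0$) and off-diagonal entries $\sqrt{\lambda_n\mu_{n+1}}$ ($n\ge0$); here the parameters are required to satisfy $c\ge0$, $c+a>0$, $c+b>0$. Model II: $J_{II}$ is $J_I$ with the $(1,1)$ entry $\lambda_0+\mu_0$ replaced by $\lambda_0$. Model III: $J_{III}$ has diagonal entries $\hat\lambda_0,\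 \lambda_1+\mu_1,\ \lambda_2+\mu_2,\dots$ and off-diagonal entries $\sqrt{\hat\lambda_0\mu_1},\sqrt{\lambda_1\mu_2},\sqrt{\lambda_2\mu_3},\dots$; here the parameters are required to satisfy $c+1>0$, $c+a+1>0$, $c+b+1>0$. In each model the matrix is understood to be a Jacobi matrix, that is, its entries are well defined, with real diagonal entries and positive off-diagonal entries. For a Jacobi matrix $J$ with bounded entries, the spectral measure (the probability measure of the corresponding orthogonal polynomials) is the unique probability measure $\mu$ on $\mathbb R$ with $\int x^k\,d\mu(x)=J^k(1,1)$ for all $k=0,1,2,\dots$, and its Stieltjes transform is $S(z)=\int\frac{d\mu(x)}{x-z}$, $z\in\mathbb C\setminus\mathbb R$. *)

theory Defs
  imports "HOL-Complex_Analysis.Complex_Analysis" "HOL-Probability.Probability"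
begin

section \<open>The Gauss hypergeometric function\<close>

text \<open>The series converges only for \<open>norm w < 1\<close>; the function is its analytic continuation
  to the plane cut along \<open>[1, \<infinity>)\<close>. Nothing is specified on the cut itself.\<close>

definition cut_plane :: "complex set" where
  "cut_plane = - {w. Im w = 0 \<and> 1 \<le> Re w}"

definition hypergeo_2F1_continuation ::
    "complex \<Rightarrow> complex \<Rightarrow> complex \<Rightarrow> (complex \<Rightarrow> complex) \<Rightarrow> bool" where
  "hypergeo_2F1_continuation \<alpha> \<beta> \<gamma> f \<longleftrightarrow>
     f holomorphic_on cut_plane \<and>
     (\<forall>w\<in>ball 0 1. f w = eval_fps (fps_hypergeo [\<alpha>, \<beta>] [\<gamma>] 1) w)"

definition hypergeo_2F1 :: "complex \<Rightarrow> complex \<Rightarrow> complex \<Rightarrow> complex \<Rightarrow> complex" where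
  "hypergeo_2F1 \<alpha> \<beta> \<gamma> w =
     (THE v. \<exists>f. hypergeo_2F1_continuation \<alpha> \<beta> \<gamma> f \<and> v = f w)"

lemma open_cut_plane: "open cut_plane"
proof -
  have "closed {w. Im w = 0 \<and> 1 \<le> Re w}"
    by (intro closed_Collect_conj closed_Collect_eq closed_Collect_le continuous_intros)
  then show ?thesis
    by (simp add: cut_plane_def open_Compl)
qed

lemma ball_subset_cut_plane: "ball 0 1 \<subseteq> cut_plane"
proof
  fix w :: complex
  assume "w \<in> ball 0 1"
  then show "w \<in> cut_plane"
    using complex_Re_le_cmod[of w] by (auto simp: cut_plane_def)
qed

lemma starlike_cut_plane: "starlike cut_plane"
  unfolding starlike_def
proof (intro bexI ballI subsetI)
  show "(0::complex) \<in> cut_plane"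
    by (simp add: cut_plane_def)
  fix w v :: complex
  assume w: "w \<in> cut_plane" and "v \<in> closed_segment 0 w"
  then obtain t where t: "0 \<le> t" "t \<le> 1" "v = t *\<^sub>R w"
    by (auto simp: closed_segment_def)
  show "v \<in> cut_plane"
  proof (rule ccontr)
    assume "v \<notin> cut_plane"
    then have v: "t * Im w = 0" "1 \<le> t * Re w"
      using t by (auto simp: cut_plane_def)
    then have "0 < t" and "Im w = 0"
      using t by (auto simp: order_less_le)
    moreover have "0 < Re w"
      using v(2) \<open>0 < t\<close> by (smt (verit) mult_nonneg_nonpos)
    moreover from this have "t * Re w \<le> Re w"
      using t mult_right_mono[of t 1 "Re w"] by simp
    ultimately show False
      using v w by (auto simp: cut_plane_def)
  qed
qed

lemma hypergeo_2F1_eqI: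
  assumes f: "hypergeo_2F1_continuation \<alpha> \<beta> \<gamma> f" and w: "w \<in> cut_plane"
  shows "hypergeo_2F1 \<alpha> \<beta> \<gamma> w = f w"
  unfolding hypergeo_2F1_def
proof (rule the_equality)
  show "\<exists>g. hypergeo_2F1_continuation \<alpha> \<beta> \<gamma> g \<and> f w = g w"
    using f by blast
  fix v
  assume "\<exists>g. hypergeo_2F1_continuation \<alpha> \<beta> \<gamma> g \<and> v = g w"
  then obtain g where g: "hypergeo_2F1_continuation \<alpha> \<beta> \<gamma> g" "v = g w"
    by blast
  have "g w = f w"
  proof (rule analytic_continuation_open[of "ball 0 1" cut_plane g f])
    show "connected cut_plane"
      by (rule starlike_imp_connected[OF starlike_cut_plane])
  qed (use f g w open_cut_plane ball_subset_cut_plane in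
        \<open>auto simp: hypergeo_2F1_continuation_def\<close>)
  with g show "v = f w" by simp
qed

section \<open>Jacobi matrices and spectral measures\<close>

text \<open>Rows and columns of infinite matrices are indexed from 0, so the entry \<open>(1,1)\<close> is
  \<open>J 0 0\<close>.\<close>

definition sym_tridiag :: "(nat \<Rightarrow> real) \<Rightarrow> (nat \<Rightarrow> real) \<Rightarrow> nat \<Rightarrow> nat \<Rightarrow> real" where
  "sym_tridiag d e i j =
     (if i = j then d i else if j = Suc i then e i else if i = Suc j then e j else 0)"

definition jacobi_matrix :: "(nat \<Rightarrow> nat \<Rightarrow> real) \<Rightarrow> bool" where
  "jacobi_matrix J \<longleftrightarrow>
     (\<forall>i j. J i j = J j i) \<and> (\<forall>i j. Suc i < j \<longrightarrow> J i j = 0) \<and> (\<forall>i. 0 < J i (Suc i))"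

text \<open>Matrix powers for matrices with finitely supported columns; for these the sum
  below is the full matrix product.\<close>

fun mat_power :: "(nat \<Rightarrow> nat \<Rightarrow> real) \<Rightarrow> nat \<Rightarrow> nat \<Rightarrow> nat \<Rightarrow> real" where
  "mat_power J 0 i j = (if i = j then 1 else 0)"
| "mat_power J (Suc k) i j = (\<Sum>l | J l j \<noteq> 0. mat_power J k i l * J l j)"

definition is_spectral_measure :: "(nat \<Rightarrow> nat \<Rightarrow> real) \<Rightarrow> real measure \<Rightarrow> bool" where
  "is_spectral_measure J M \<longleftrightarrow>
     prob_space M \<and> sets M = sets borel \<and>
     (\<forall>k. integrable M (\<lambda>x. x ^ k) \<and> (\<integral>x. x ^ k \<partial>M) = mat_power J k 0 0)"

definition spectral_measure :: "(nat \<Rightarrow> nat \<Rightarrow> real) \<Rightarrow> real measure" where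
  "spectral_measure J = (THE M. is_spectral_measure J M)"

definition stieltjes :: "real measure \<Rightarrow> complex \<Rightarrow> complex" where
  "stieltjes M z = (\<integral>x. 1 / (complex_of_real x - z) \<partial>M)"

section \<open>The three models of associated Jacobi polynomials\<close>

definition jac_lambda_hat :: "real \<Rightarrow> real \<Rightarrow> real \<Rightarrow> real" where
  "jac_lambda_hat a b c = (c + a + 1) / (2*c + a + b + 2)"

definition jac_lambda :: "real \<Rightarrow> real \<Rightarrow> real \<Rightarrow> nat \<Rightarrow> real" where
  "jac_lambda a b c n =
     (real n + c + a + 1) / (2 * real n + 2*c + a + b + 2) *
     ((real n + c + a + b + 1) / (2 * real n + 2*c + a + b + 1))"

definition jac_mu :: "real \<Rightarrow> real \<Rightarrow> real \<Rightarrow> nat \<Rightarrow> real" where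
  "jac_mu a b c n =
     (real n + c) / (2 * real n + 2*c + a + b + 1) *
     ((real n + c + b) / (2 * real n + 2*c + a + b))"

definition J_I :: "real \<Rightarrow> real \<Rightarrow> real \<Rightarrow> nat \<Rightarrow> nat \<Rightarrow> real" where
  "J_I a b c = sym_tridiag
     (\<lambda>n. jac_lambda a b c n + jac_mu a b c n)
     (\<lambda>n. sqrt (jac_lambda a b c n * jac_mu a b c (Suc n)))"

definition J_II :: "real \<Rightarrow> real \<Rightarrow> real \<Rightarrow> nat \<Rightarrow> nat \<Rightarrow> real" where
  "J_II a b c i j = (if i = 0 \<and> j = 0 then jac_lambda a b c 0 else J_I a b c i j)"

definition J_III :: "real \<Rightarrow> real \<Rightarrow> real \<Rightarrow> nat \<Rightarrow> nat \<Rightarrow> real" where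
  "J_III a b c = sym_tridiag
     (\<lambda>n. if n = 0 then jac_lambda_hat a b c else jac_lambda a b c n + jac_mu a b c n)
     (\<lambda>n. sqrt ((if n = 0 then jac_lambda_hat a b c else jac_lambda a b c n) *
                jac_mu a b c (Suc n)))"

text \<open>The inequalities on \<open>a, b, c\<close> make all denominators in the entries positive. They do
  not make the radicands positive (take \<open>c = 10\<close>, \<open>a = b = -9.9\<close>), so that is required
  separately; since \<open>sqrt x > 0\<close> iff \<open>x > 0\<close> in HOL, \<open>jacobi_matrix\<close> says exactly this.
  Model II modifies the matrix of Model I and so inherits its parameter range.\<close>

definition model_I :: "real \<Rightarrow> real \<Rightarrow> real \<Rightarrow> bool" where
  "model_I a b c \<longleftrightarrow> 0 \<le> c \<and> 0 < c + a \<and> 0 < c + b \<and> jacobi_matrix (J_I a b c)"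

definition model_II :: "real \<Rightarrow> real \<Rightarrow> real \<Rightarrow> bool" where
  "model_II a b c \<longleftrightarrow> 0 \<le> c \<and> 0 < c + a \<and> 0 < c + b \<and> jacobi_matrix (J_II a b c)"

definition model_III :: "real \<Rightarrow> real \<Rightarrow> real \<Rightarrow> bool" where
  "model_III a b c \<longleftrightarrow>
     0 < c + 1 \<and> 0 < c + a + 1 \<and> 0 < c + b + 1 \<and> jacobi_matrix (J_III a b c)"

end

theory Submission
  imports Defs "HOL-Real_Asymp.Real_Asymp"
begin

text \<open>Put \<open>w = 1 / z\<close> and \<open>T w = \<integral> 1 / (1 - w x) d\<mu>(x)\<close>, so that \<open>S z = - w T w\<close>. Gauss's contiguous
  relations give a three-term recurrence for \<open>F\<^sub>n = \<^sub>2F\<^sub>1(c + n, c + a + n; 2c + a + b + 2n; w)\<close> whose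
  coefficients are the entries of the Jacobi matrix. Hence, as formal power series, the moment
  generating function times the denominator \<open>D\<close> of the ratio equals the numerator \<open>N\<close>, and analytic
  continuation yields \<open>T D = N\<close> off the real axis. The denominator has no zero there: in each model
  a contiguous relation expresses \<open>D'\<close> through \<open>D\<close> and \<open>N\<close>, and substituting \<open>N = T D\<close> gives a linear
  equation \<open>D' = h D\<close> with \<open>h\<close> holomorphic on each half-plane, so one zero would make \<open>D\<close> vanish.

  Both the spectral measure and the measure in Euler's integral for \<open>\<^sub>2F\<^sub>1\<close> (which provides the
  continuation to the cut plane) come from the Hausdorff moment problem. For a Jacobi matrix \<open>J\<close>
  with \<open>R \<plusminus> J\<close> positive semidefinite, the positivity needed is that of
  \<open>\<langle>\<delta>\<^sub>0, (R + J)\<^sup>k (R - J)\<^sup>m \<delta>\<^sub>0\<rangle>\<close>.\<close>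

section \<open>The Hausdorff moment problem\<close>

text \<open>Each use of \<open>step\<close> splits an entry between its two successors, so n uses
  spread it over a later antidiagonal with binomial weights. If \<open>A k m\<close> is the integral
  of x^k (1 - x)^m, this is the expansion of (x + (1 - x))^n under the integral.\<close>

lemma pascal_array_expand:
  fixes A :: "nat \<Rightarrow> nat \<Rightarrow> real"
  assumes step: "\<And>k m. A k m = A (Suc k) m + A k (Suc m)"
  shows "(\<Sum>k\<le>n. real (n choose k) * A (j + k) (m + (n - k))) = A j m"
proof (induction n arbitrary: j m)
  case (Suc n)
  have "(\<Sum>k\<le>Suc n. real (Suc n choose k) * A (j + k) (m + (Suc n - k))) =
      A j (m + Suc n) + (\<Sum>k\<le>n. real (n choose Suc k) * A (j + Suc k) (m + (n - k)))
       + (\<Sum>k\<le>n. real (n choose k) * A (Suc j + k) (m + (n - k)))"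
    by (subst sum.atMost_Suc_shift) (simp add: algebra_simps sum.distrib)
  also have "A j (m + Suc n) + (\<Sum>k\<le>n. real (n choose Suc k) * A (j + Suc k) (m + (n - k))) =
      (\<Sum>k\<le>Suc n. real (n choose k) * A (j + k) (m + (Suc n - k)))"
    using sum.atMost_Suc_shift[of "\<lambda>k. real (n choose k) * A (j + k) (m + (Suc n - k))" n] by simp
  also have "\<dots> = (\<Sum>k\<le>n. real (n choose k) * A (j + k) (Suc m + (n - k)))"
    by (simp add: Suc_diff_le)
  also have "\<dots> = A j (Suc m)"
    by (rule Suc.IH)
  finally show ?case
    using Suc.IH[of "Suc j" m] step[of j m] by simp
qed simp

text \<open>Trading \<open>(n choose k) * (k choose j)\<close> for
  \<open>(n choose j) * ((n - j) choose (k - j))\<close> leaves the expansion of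
  \<open>A j 0\<close> over n - j steps. Binomial moments of the weights are therefore exact, and
  only the passage to power moments needs an estimate.\<close>

lemma pascal_array_factorial_moment:
  fixes A :: "nat \<Rightarrow> nat \<Rightarrow> real"
  assumes step: "\<And>k m. A k m = A (Suc k) m + A k (Suc m)" and "j \<le> n"
  shows "(\<Sum>k\<le>n. real (k choose j) * (real (n choose k) * A k (n - k))) = real (n choose j) * A j 0"
proof -
  have "(\<Sum>k\<le>n. real (k choose j) * (real (n choose k) * A k (n - k))) =
      (\<Sum>k\<in>{j..n}. real (k choose j) * (real (n choose k) * A k (n - k)))"
    by (rule sum.mono_neutral_right) (auto simp: not_le)
  also have "\<dots> = (\<Sum>k\<in>{j..n}. real (n choose j) * (real ((n - j) choose (k - j)) * A k (n - k)))"
  proof (rule sum.cong[OF refl])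
    fix k assume "k \<in> {j..n}"
    then have "(n choose k) * (k choose j) = (n choose j) * ((n - j) choose (k - j))"
      by (intro choose_mult) auto
    then have "real (n choose k) * real (k choose j) = real (n choose j) * real ((n - j) choose (k - j))"
      by (metis of_nat_mult)
    then show "real (k choose j) * (real (n choose k) * A k (n - k)) =
        real (n choose j) * (real ((n - j) choose (k - j)) * A k (n - k))"
      by (simp add: algebra_simps)
  qed
  also have "\<dots> = (\<Sum>i\<le>n - j. real (n choose j) * (real ((n - j) choose i) * A (j + i) (0 + (n - j - i))))"
    by (rule sum.reindex_bij_witness[of _ "\<lambda>i. j + i" "\<lambda>k. k - j"]) (use \<open>j \<le> n\<close> in auto)
  also have "\<dots> = real (n choose j) * A j 0"
    by (simp only: sum_distrib_left[symmetric] pascal_array_expand[of A, OF step])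
  finally show ?thesis .
qed

text \<open>Both quantities are products of j factors of absolute value at most 1, namely (k - i) /
  (n - i) and k / n, so their difference is at most the sum of the differences of the
  factors.\<close>

lemma choose_ratio_approx:
  assumes "k \<le> n" "2 * j < n"
  shows "\<bar>real (k choose j) / real (n choose j) - (real k / real n) ^ j\<bar> \<le> real j * (real j / (real n - real j))"
proof -
  define x where "x i = (real k - real i) / (real n - real i)" for i
  have ratio: "real (k choose j) / real (n choose j) = (\<Prod>i\<in>{0..<j}. x i)"
    by (simp add: binomial_gbinomial gbinomial_prod_rev x_def prod_dividef)
  have "norm ((\<Prod>i\<in>{0..<j}. x i) - (\<Prod>i\<in>{0..<j}. real k / real n)) \<le>
      (\<Sum>i\<in>{0..<j}. norm (x i - real k / real n))"
  proof (rule norm_prod_diff)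
    fix i assume "i \<in> {0..<j}"
    \<comment> \<open>For k < i the factor is negative; \<open>2 * j < n\<close> then keeps i - k
      below n - i.\<close>
    then show "norm (x i) \<le> 1"
      using assms by (auto simp: x_def abs_le_iff divide_simps)
  qed (use assms in auto)
  also have "\<dots> \<le> (\<Sum>i\<in>{0..<j}. real j / (real n - real j))"
  proof (rule sum_mono)
    fix i assume i: "i \<in> {0..<j}"
    have "x i - real k / real n = - (real i * (real n - real k) / (real n * (real n - real i)))"
      using i assms by (simp add: x_def field_simps)
    then have "norm (x i - real k / real n) = (real i / (real n - real i)) * ((real n - real k) / real n)"
      using i assms by (simp add: abs_mult)
    also have "\<dots> \<le> (real i / (real n - real i)) * 1"
      using i assms by (intro mult_left_mono) auto
    also have "\<dots> \<le> real j / (real n - real j)"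
      using i assms by (auto intro!: frac_le)
    finally show "norm (x i - real k / real n) \<le> real j / (real n - real j)" .
  qed
  finally show ?thesis
    by (simp add: ratio)
qed

text \<open>\<open>M n\<close> puts mass \<open>(n choose k) * A k (n - k)\<close> at k / n, as in
  Bernstein's approximation. The second conclusion expresses that \<open>M n\<close> lives on
  [0, 1]. The interval in the third starts at -1 because tightness is stated with half-open
  intervals and the point 0 has to lie inside.\<close>

lemma bernstein_measures:
  fixes A :: "nat \<Rightarrow> nat \<Rightarrow> real"
  assumes nonneg: "\<And>k m. 0 \<le> A k m" and one: "A 0 0 = 1"
    and step: "\<And>k m. A k m = A (Suc k) m + A k (Suc m)"
  obtains M where "\<And>n. real_distribution (M n)"
    "\<And>n f g. (\<And>x. 0 \<le> x \<Longrightarrow> x \<le> 1 \<Longrightarrow> f x = g x) \<Longrightarrow> f \<in> borel_measurable borel \<Longrightarrow>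
       g \<in> borel_measurable borel \<Longrightarrow> (\<integral>x. f x \<partial>M n) = (\<integral>x. g x \<partial>M n :: real)"
    "\<And>n. measure (M n) {-1<..1} = 1"
    "\<And>j. (\<lambda>n. \<integral>x. x ^ j \<partial>M n) \<longlonglongrightarrow> A j 0"
proof -
  define w where "w n k = real (n choose k) * A k (n - k)" for n k
  have w_nonneg: "0 \<le> w n k" for n k
    by (simp add: w_def nonneg)
  have w_0: "w n k = 0" if "k > n" for n k
    using that by (simp add: w_def)
  have w_sum: "(\<Sum>k\<le>n. w n k) = 1" for n
    using pascal_array_expand[of A n 0 0, OF step] by (simp add: w_def one)
  have w_nn: "(\<integral>\<^sup>+k. ennreal (w n k) \<partial>count_space UNIV) = 1" for n
  proof -
    have "(\<integral>\<^sup>+k. ennreal (w n k) \<partial>count_space UNIV) = (\<Sum>k\<in>{..n}. ennreal (w n k))"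
      by (rule nn_integral_count_space') (auto simp: w_0 not_le)
    then show ?thesis
      by (simp add: sum_ennreal w_nonneg w_sum)
  qed
  define p where "p n = embed_pmf (w n)" for n
  have pmf_p: "pmf (p n) k = w n k" for n k
    unfolding p_def by (rule pmf_embed_pmf[OF w_nonneg w_nn])
  have set_p: "k \<le> n" if "k \<in> set_pmf (p n)" for n k
    using that w_0[of n k] by (cases "k \<le> n") (auto simp: set_pmf_eq pmf_p)
  define M where "M n = distr (measure_pmf (p n)) borel (\<lambda>k. real k / real n)" for n
  have unit: "0 \<le> real k / real n" "real k / real n \<le> 1" if "k \<in> set_pmf (p n)" for n k
    using set_p[OF that] by (auto simp: divide_simps)
  have int_M: "(\<integral>x. f x \<partial>M n) = (\<Sum>k\<le>n. f (real k / real n) * w n k)"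
    if [measurable]: "f \<in> borel_measurable borel" for f :: "real \<Rightarrow> real" and n
  proof -
    have "(\<integral>x. f x \<partial>M n) = (\<integral>k. f (real k / real n) \<partial>measure_pmf (p n))"
      unfolding M_def by (rule integral_distr) auto
    also have "\<dots> = (\<Sum>k\<le>n. f (real k / real n) * pmf (p n) k)"
      by (rule integral_measure_pmf_real) (auto dest: set_p)
    finally show ?thesis by (simp add: pmf_p)
  qed
  have rd: "real_distribution (M n)" for n
    unfolding M_def by (rule prob_space.real_distribution_distr) (auto simp: measure_pmf.prob_space_axioms)
  show thesis
  proof (rule that[of M])
    show "real_distribution (M n)" for n by (rule rd)
    show "(\<integral>x. f x \<partial>M n) = (\<integral>x. g x \<partial>M n)"
      if "\<And>x. 0 \<le> x \<Longrightarrow> x \<le> 1 \<Longrightarrow> f x = g x" "f \<in> borel_measurable borel"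
        "g \<in> borel_measurable borel" for n and f g :: "real \<Rightarrow> real"
    proof -
      have "f (real k / real n) = g (real k / real n)" if "k \<le> n" for k
        using that \<open>\<And>x. 0 \<le> x \<Longrightarrow> x \<le> 1 \<Longrightarrow> f x = g x\<close> by (auto simp: divide_simps)
      then show ?thesis
        using that by (simp add: int_M)
    qed
    show "measure (M n) {-1<..1} = 1" for n
    proof -
      have "measure (M n) {-1<..1} = measure (measure_pmf (p n)) ((\<lambda>k. real k / real n) -` {-1<..1})"
        unfolding M_def by (subst measure_distr) auto
      also have "\<dots> = 1"
        using unit[of _ n]
        by (subst measure_pmf.prob_eq_1)
           (auto simp: AE_measure_pmf_iff intro: less_le_trans[of "-1" 0])
      finally show ?thesis .
    qed
    show "(\<lambda>n. \<integral>x. x ^ j \<partial>M n) \<longlonglongrightarrow> A j 0" for j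
    proof -
      have bound: "\<bar>(\<integral>x. x ^ j \<partial>M n) - A j 0\<bar> \<le> real j * (real j / (real n - real j))" if n: "2 * j < n" for n
      proof -
        have pos: "0 < real (n choose j)"
          using n by simp
        have "A j 0 = (\<Sum>k\<le>n. real (k choose j) / real (n choose j) * w n k)"
          using pascal_array_factorial_moment[of A j n, OF step] n pos
          by (simp add: w_def sum_divide_distrib[symmetric] field_simps)
        then have "(\<integral>x. x ^ j \<partial>M n) - A j 0 =
            (\<Sum>k\<le>n. ((real k / real n) ^ j - real (k choose j) / real (n choose j)) * w n k)"
          by (simp add: int_M sum_subtractf left_diff_distrib)
        also have "\<bar>\<dots>\<bar> \<le> (\<Sum>k\<le>n. real j * (real j / (real n - real j)) * w n k)"
        proof (rule order_trans[OF sum_abs sum_mono])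
          fix k assume "k \<in> {..n}"
          then have "\<bar>(real k / real n) ^ j - real (k choose j) / real (n choose j)\<bar>
              \<le> real j * (real j / (real n - real j))"
            using choose_ratio_approx[of k n j] n by (simp add: abs_minus_commute)
          from mult_right_mono[OF this w_nonneg[of n k]]
          show "\<bar>((real k / real n) ^ j - real (k choose j) / real (n choose j)) * w n k\<bar>
              \<le> real j * (real j / (real n - real j)) * w n k"
            by (simp only: abs_mult abs_of_nonneg[OF w_nonneg])
        qed
        also have "\<dots> = real j * (real j / (real n - real j))"
          by (simp only: sum_distrib_left[symmetric] w_sum)
        finally show ?thesis .
      qed
      have "(\<lambda>n. (\<integral>x. x ^ j \<partial>M n) - A j 0) \<longlonglongrightarrow> 0"
      proof (rule Lim_null_comparison)
        show "\<forall>\<^sub>F n in sequentially. norm ((\<integral>x. x ^ j \<partial>M n) - A j 0) \<le> real j * (real j / (real n - real j))"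
          using eventually_gt_at_top[of "2 * j"] by eventually_elim (use bound in auto)
        show "(\<lambda>n. real j * (real j / (real n - real j))) \<longlonglongrightarrow> 0"
          by real_asymp
      qed
      then show ?thesis
        by (simp add: LIM_zero_iff)
    qed
  qed
qed

text \<open>Tightness yields a weak limit of a subsequence of the Bernstein measures. Bounded
  continuous test functions show that the limit is carried by [0, 1] and has the prescribed
  moments.\<close>

theorem hausdorff_moment:
  fixes A :: "nat \<Rightarrow> nat \<Rightarrow> real"
  assumes "\<And>k m. 0 \<le> A k m" and "A 0 0 = 1"
    and "\<And>k m. A k m = A (Suc k) m + A k (Suc m)"
  obtains M where "real_distribution M" "AE x in M. 0 \<le> x \<and> x \<le> 1"
    "\<And>j. (\<integral>x. x ^ j \<partial>M) = A j 0"
proof -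
  obtain M where M: "\<And>n. real_distribution (M n)"
    and cong: "\<And>n f g. (\<And>x. 0 \<le> x \<Longrightarrow> x \<le> 1 \<Longrightarrow> f x = g x) \<Longrightarrow> f \<in> borel_measurable borel \<Longrightarrow>
       g \<in> borel_measurable borel \<Longrightarrow> (\<integral>x. f x \<partial>M n) = (\<integral>x. g x \<partial>M n :: real)"
    and unit: "\<And>n. measure (M n) {-1<..1} = 1"
    and lim: "\<And>j. (\<lambda>n. \<integral>x. x ^ j \<partial>M n) \<longlonglongrightarrow> A j 0"
    using bernstein_measures[of A] assms by blast
  have "tight M"
    unfolding tight_def using M unit by (intro conjI allI impI exI[of _ "-1"] exI[of _ 1]) auto
  then obtain r N where r: "strict_mono r" and N: "real_distribution N"
    and weak: "weak_conv_m (M \<circ> id \<circ> r) N"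
    using tight_imp_convergent_subsubsequence[of M id] by (auto simp: strict_mono_def)
  interpret N: real_distribution N by (rule N)
  have conv: "(\<lambda>n. \<integral>x. f x \<partial>M (r n)) \<longlonglongrightarrow> (\<integral>x. f x \<partial>N)"
    if "\<And>x. isCont f x" "\<And>x. norm (f x) \<le> B" for f :: "real \<Rightarrow> real" and B
    using weak_conv_imp_integral_bdd_continuous_conv[of "M \<circ> id \<circ> r" N f B] M N weak that
    by (simp add: o_def)
  \<comment> \<open>A bounded continuous function vanishing exactly on [0, 1]: its integrals against
    the \<open>M n\<close> are 0, hence so is its integral against the limit.\<close>
  define h :: "real \<Rightarrow> real" where "h x = min 1 (max 0 (max (- x) (x - 1)))" for x
  have h_cont: "isCont h x" for x
    unfolding h_def by (intro continuous_intros)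
  then have [measurable]: "h \<in> borel_measurable borel"
    by (intro borel_measurable_continuous_onI continuous_at_imp_continuous_on) auto
  have h_bounds: "0 \<le> h x" "h x \<le> 1" for x
    by (auto simp: h_def)
  have "(\<integral>x. h x \<partial>M n) = 0" for n
    using cong[of h "\<lambda>_. 0" n] by (simp add: h_def)
  then have "(\<integral>x. h x \<partial>N) = 0"
    using conv[of h 1] h_cont h_bounds by (simp add: LIMSEQ_const_iff)
  moreover have "integrable N h"
    by (rule N.integrable_const_bound[of _ 1]) (use h_bounds in auto)
  ultimately have "AE x in N. h x = 0"
    using integral_nonneg_eq_0_iff_AE[of N h] h_bounds by simp
  then have supp: "AE x in N. 0 \<le> x \<and> x \<le> 1"
    by eventually_elim (auto simp: h_def min_def max_def split: if_splits)
  have "(\<integral>x. x ^ j \<partial>N) = A j 0" for j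
  proof -
    \<comment> \<open>Powers are unbounded on the line, so the argument is clamped to [0, 1], which
      changes nothing on the supports.\<close>
    define g :: "real \<Rightarrow> real" where "g x = (max 0 (min 1 x)) ^ j" for x
    have g_cont: "isCont g x" for x
      unfolding g_def by (intro continuous_intros)
    then have [measurable]: "g \<in> borel_measurable borel"
      by (intro borel_measurable_continuous_onI continuous_at_imp_continuous_on) auto
    have "norm (g x) \<le> 1" for x
      by (auto simp: g_def intro!: power_le_one)
    then have "(\<lambda>n. \<integral>x. g x \<partial>M (r n)) \<longlonglongrightarrow> (\<integral>x. g x \<partial>N)"
      by (rule conv[OF g_cont])
    moreover have "(\<integral>x. g x \<partial>M n) = (\<integral>x. x ^ j \<partial>M n)" for n
      by (rule cong) (auto simp: g_def)
    moreover have "(\<lambda>n. \<integral>x. x ^ j \<partial>M (r n)) \<longlonglongrightarrow> A j 0"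
      using LIMSEQ_subseq_LIMSEQ[OF lim r] by (simp add: o_def)
    ultimately have "(\<integral>x. g x \<partial>N) = A j 0"
      using LIMSEQ_unique by simp
    moreover have "(\<integral>x. g x \<partial>N) = (\<integral>x. x ^ j \<partial>N)"
    proof (rule integral_cong_AE)
      show "AE x in N. g x = x ^ j"
        using supp by eventually_elim (auto simp: g_def)
    qed auto
    ultimately show ?thesis by simp
  qed
  with N supp show thesis by (rule that)
qed

section \<open>Bounded Jacobi matrices\<close>

definition tridiag_op :: "(nat \<Rightarrow> real) \<Rightarrow> (nat \<Rightarrow> real) \<Rightarrow> (nat \<Rightarrow> real) \<Rightarrow> nat \<Rightarrow> real" where
  "tridiag_op d e v i = d i * v i + (case i of 0 \<Rightarrow> 0 | Suc j \<Rightarrow> e j * v j) + e i * v (Suc i)"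

lemma sum_sym_tridiag:
  "(\<Sum>l | sym_tridiag d e l j \<noteq> 0. f l * sym_tridiag d e l j) = tridiag_op d e f j"
proof -
  let ?S = "case j of 0 \<Rightarrow> {j, Suc j} | Suc i \<Rightarrow> {i, j, Suc j}"
  have "(\<Sum>l | sym_tridiag d e l j \<noteq> 0. f l * sym_tridiag d e l j) =
      (\<Sum>l\<in>?S. f l * sym_tridiag d e l j)"
    by (rule sum.mono_neutral_left) (auto simp: sym_tridiag_def split: nat.splits if_splits)
  also have "\<dots> = tridiag_op d e f j"
    by (cases j) (auto simp: sym_tridiag_def tridiag_op_def)
  finally show ?thesis .
qed

lemma mat_power_sym_tridiag:
  "mat_power (sym_tridiag d e) (Suc k) i = tridiag_op d e (mat_power (sym_tridiag d e) k i)"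
  by (simp add: fun_eq_iff sum_sym_tridiag)

text \<open>Summation by parts: by symmetry of the matrix all terms cancel except those at the
  truncation index. The boundary term vanishes as soon as both vectors vanish at
  \<open>n\<close>.\<close>

lemma tridiag_op_green:
  "(\<Sum>i\<le>n. tridiag_op d e v i * u i) - (\<Sum>i\<le>n. v i * tridiag_op d e u i) =
     e n * (v (Suc n) * u n - v n * u (Suc n))"
  by (induction n) (simp_all add: tridiag_op_def algebra_simps)

text \<open>Of the budget \<open>3 * B\<close> at each coordinate, one \<open>B\<close> pays for the
  diagonal entry and one for each of the two neighbouring off-diagonal entries. The left side is
  what the induction carries along: the half-counted bond between n and n + 1 and the
  \<open>B\<close> reserved for it. It is 0 when \<open>v n = 0\<close>. The sign \<open>s\<close>
  treats R + J and R - J together.\<close>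

lemma tridiag_op_form_bound:
  fixes s :: real
  assumes "\<And>n. \<bar>d n\<bar> \<le> B" "\<And>n. \<bar>e n\<bar> \<le> B" "\<bar>s\<bar> = 1"
  shows "s * e n * v n * v (Suc n) + B * (v n)\<^sup>2 \<le>
    (\<Sum>i\<le>n. 3 * B * (v i)\<^sup>2 + s * (v i * tridiag_op d e v i))"
proof -
  have diag: "0 \<le> B * x\<^sup>2 + s * (d n * x\<^sup>2)" for n x
  proof -
    have "\<bar>s * (d n * x\<^sup>2)\<bar> \<le> B * x\<^sup>2"
      using assms(1)[of n] assms(3) by (simp add: abs_mult mult_right_mono)
    then show ?thesis by linarith
  qed
  have off: "0 \<le> B * x\<^sup>2 + B * y\<^sup>2 + 2 * (s * e n * x * y)" for n x y
  proof -
    have "\<bar>2 * (s * e n * x * y)\<bar> \<le> B * (2 * (\<bar>x\<bar> * \<bar>y\<bar>))"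
      using mult_right_mono[OF assms(2)[of n], of "2 * (\<bar>x\<bar> * \<bar>y\<bar>)"] assms(3) by (simp add: abs_mult)
    also have "\<dots> \<le> B * (x\<^sup>2 + y\<^sup>2)"
      using assms(1)[of 0] sum_squares_bound[of "\<bar>x\<bar>" "\<bar>y\<bar>"] by (intro mult_left_mono) auto
    finally show ?thesis by (simp add: distrib_left)
  qed
  have "0 \<le> B"
    using assms(1)[of 0] by simp
  show ?thesis
  proof (induction n)
    case 0
    have "0 \<le> B * (v 0)\<^sup>2"
      using \<open>0 \<le> B\<close> by simp
    then show ?case
      using diag[of "v 0" 0] by (simp add: tridiag_op_def algebra_simps power2_eq_square)
  next
    case (Suc n)
    then show ?case
      using diag[of "v (Suc n)" "Suc n"] off[of "v n" "v (Suc n)" n]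
      by (simp add: tridiag_op_def algebra_simps power2_eq_square)
  qed
qed

text \<open>The Taylor polynomials of a characteristic function depend on the moments alone, and
  geometric growth of the even moments drives the remainder to 0 for every t. Hence the
  characteristic functions agree.\<close>

lemma real_distribution_eqI_moments:
  assumes "real_distribution M" "real_distribution N"
    and int: "\<And>k. integrable M (\<lambda>x. x ^ k)" "\<And>k. integrable N (\<lambda>x. x ^ k)"
    and eq: "\<And>k. (\<integral>x. x ^ k \<partial>M) = (\<integral>x. x ^ k \<partial>N)"
    and bound: "\<And>k. (\<integral>x. x ^ (2 * k) \<partial>M) \<le> R ^ (2 * k)"
  shows "M = N"
proof (rule Levy_uniqueness[OF assms(1,2)], rule ext)
  interpret M: real_distribution M by fact
  interpret N: real_distribution N by fact
  fix t
  have close: "cmod (char M t - char N t) \<le> 4 * ((\<bar>t\<bar> * R) ^ (2 * n) / fact (2 * n))" for n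
  proof -
    \<comment> \<open>The common Taylor polynomial. Its order is even so that the absolute moment in
      the remainder is an ordinary moment.\<close>
    define S where "S = (\<Sum>k\<le>2 * n. ((\<i> * t) ^ k / fact k) * (\<integral>x. x ^ k \<partial>M))"
    have "2 * \<bar>t\<bar> ^ (2 * n) / fact (2 * n) * (\<integral>x. x ^ (2 * n) \<partial>M) \<le>
        2 * \<bar>t\<bar> ^ (2 * n) / fact (2 * n) * R ^ (2 * n)"
      by (intro mult_left_mono bound) auto
    also have "\<dots> = 2 * ((\<bar>t\<bar> * R) ^ (2 * n) / fact (2 * n))"
      by (simp add: power_mult_distrib)
    finally have b: "2 * \<bar>t\<bar> ^ (2 * n) / fact (2 * n) * (\<integral>x. x ^ (2 * n) \<partial>M) \<le>
        2 * ((\<bar>t\<bar> * R) ^ (2 * n) / fact (2 * n))" .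
    have "cmod (char M t - S) \<le> 2 * ((\<bar>t\<bar> * R) ^ (2 * n) / fact (2 * n))"
      using M.char_approx1[of "2 * n" t, OF int(1)] b by (simp add: S_def power_even_abs)
    moreover have "cmod (char N t - S) \<le> 2 * ((\<bar>t\<bar> * R) ^ (2 * n) / fact (2 * n))"
      using N.char_approx1[of "2 * n" t, OF int(2)] b by (simp add: S_def eq power_even_abs)
    ultimately show ?thesis
      using norm_triangle_ineq4[of "char M t - S" "char N t - S"] by simp
  qed
  have "(\<lambda>n. (\<bar>t\<bar> * R) ^ n / fact n) \<longlonglongrightarrow> 0"
    using summable_LIMSEQ_zero[OF summable_exp[of "\<bar>t\<bar> * R"]] by (simp add: divide_inverse mult.commute)
  moreover have "strict_mono (\<lambda>n::nat. 2 * n)"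
    by (simp add: strict_mono_def)
  ultimately have "(\<lambda>n. (\<bar>t\<bar> * R) ^ (2 * n) / fact (2 * n)) \<longlonglongrightarrow> 0"
    using LIMSEQ_subseq_LIMSEQ by (fastforce simp: o_def)
  then have "(\<lambda>n. 4 * ((\<bar>t\<bar> * R) ^ (2 * n) / fact (2 * n))) \<longlonglongrightarrow> 0"
    by (rule tendsto_mult_right_zero)
  then have "cmod (char M t - char N t) \<le> 0"
    using close by (intro LIMSEQ_le_const) auto
  then show "char M t = char N t" by simp
qed

section \<open>Existence and uniqueness of the spectral measure of a bounded Jacobi matrix\<close>

locale bounded_jacobi =
  fixes d e :: "nat \<Rightarrow> real" and B :: real
  assumes d_bound: "\<bar>d n\<bar> \<le> B" and e_bound: "\<bar>e n\<bar> \<le> B" and B_pos: "0 < B"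
begin

abbreviation "T \<equiv> tridiag_op d e"

text \<open>With R = 3 B, \<open>upper\<close> is (R + J) / (2 R) and \<open>lower\<close> is (R -
  J) / (2 R). They commute and add up to the identity, and so play the parts of x and 1 - x once
  [-R, R] is mapped affinely onto [0, 1].\<close>

definition upper :: "(nat \<Rightarrow> real) \<Rightarrow> nat \<Rightarrow> real" where
  "upper v i = (v i + T v i / (3 * B)) / 2"

definition lower :: "(nat \<Rightarrow> real) \<Rightarrow> nat \<Rightarrow> real" where
  "lower v i = (v i - T v i / (3 * B)) / 2"

definition delta :: "nat \<Rightarrow> real" where
  "delta i = (if i = 0 then 1 else 0)"

text \<open>The entry at index 0 is the value prescribed for the integral of x^k (1 - x)^m.\<close>

definition word :: "nat \<Rightarrow> nat \<Rightarrow> nat \<Rightarrow> real" where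
  "word k m = (upper ^^ k) ((lower ^^ m) delta)"

text \<open>For finitely supported vectors and large \<open>n\<close> this is the full inner
  product; the finite sum avoids any question of summability.\<close>

definition ip :: "nat \<Rightarrow> (nat \<Rightarrow> real) \<Rightarrow> (nat \<Rightarrow> real) \<Rightarrow> real" where
  "ip n v u = (\<Sum>i\<le>n. v i * u i)"

lemma upper_plus_lower: "upper v i + lower v i = v i"
  by (simp add: upper_def lower_def field_simps)

lemma T_eq_upper: "T v i = 6 * B * upper v i - 3 * B * v i"
  using B_pos by (simp add: upper_def field_simps)

lemma T_eq_lower: "T v i = 3 * B * v i - 6 * B * lower v i"
  using B_pos by (simp add: lower_def field_simps)

lemma T_upper: "T (upper v) = upper (T v)"
  by (simp add: fun_eq_iff upper_def tridiag_op_def algebra_simps add_divide_distrib split: nat.splits)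

lemma T_upper_power: "T ((upper ^^ k) v) = (upper ^^ k) (T v)"
  by (induction k) (simp_all add: T_upper)

lemma lower_upper: "lower (upper v) = upper (lower v)"
  by (simp add: fun_eq_iff upper_def lower_def tridiag_op_def algebra_simps add_divide_distrib
      diff_divide_distrib split: nat.splits)

lemma lower_upper_power: "lower ((upper ^^ k) v) = (upper ^^ k) (lower v)"
  by (induction k) (simp_all add: lower_upper)

lemma upper_word: "upper (word k m) = word (Suc k) m"
  by (simp add: word_def)

lemma lower_word: "lower (word k m) = word k (Suc m)"
  by (simp add: word_def lower_upper_power)

lemma word_step: "word k m i = word (Suc k) m i + word k (Suc m) i"
  using upper_plus_lower[of "word k m" i] by (simp add: upper_word lower_word)

lemma vanish_upper: "(\<forall>i\<ge>n. v i = 0) \<Longrightarrow> \<forall>i\<ge>Suc n. upper v i = 0"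
  by (auto simp: upper_def tridiag_op_def split: nat.splits)

lemma vanish_lower: "(\<forall>i\<ge>n. v i = 0) \<Longrightarrow> \<forall>i\<ge>Suc n. lower v i = 0"
  by (auto simp: lower_def tridiag_op_def split: nat.splits)

text \<open>Each tridiagonal factor enlarges the support by at most one index, starting from the
  support {0} of \<open>delta\<close>.\<close>

lemma word_vanish: "Suc (k + m) \<le> i \<Longrightarrow> word k m i = 0"
proof -
  have "\<forall>i\<ge>Suc m. (lower ^^ m) delta i = 0"
    by (induction m) (simp_all add: delta_def vanish_lower del: funpow.simps(2), use vanish_lower in auto)
  then have "\<forall>i\<ge>Suc m + k. word k m i = 0"
    unfolding word_def by (induction k) (use vanish_upper in auto)
  then show "Suc (k + m) \<le> i \<Longrightarrow> word k m i = 0"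
    by (simp add: add.commute)
qed

lemma ip_T:
  assumes "v n = 0" "u n = 0"
  shows "ip n (T v) u = ip n v (T u)"
  using tridiag_op_green[of d e v u n] assms by (simp add: ip_def)

lemma ip_upper_eq: "ip n v (upper u) = (ip n v u + ip n v (T u) / (3 * B)) / 2"
  unfolding ip_def upper_def sum_divide_distrib sum.distrib[symmetric]
  by (simp add: algebra_simps add_divide_distrib)

lemma ip_lower_eq: "ip n v (lower u) = (ip n v u - ip n v (T u) / (3 * B)) / 2"
  unfolding ip_def lower_def sum_divide_distrib sum_subtractf[symmetric]
  by (simp add: algebra_simps diff_divide_distrib)

lemma ip_commute: "ip n v u = ip n u v"
  by (simp add: ip_def mult.commute)

lemma ip_upper:
  assumes "v n = 0" "u n = 0"
  shows "ip n (upper v) u = ip n v (upper u)"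
  using ip_T[of v n u, OF assms] ip_upper_eq[of n u v] ip_upper_eq[of n v u] by (simp add: ip_commute)

lemma ip_lower:
  assumes "v n = 0" "u n = 0"
  shows "ip n (lower v) u = ip n v (lower u)"
  using ip_T[of v n u, OF assms] ip_lower_eq[of n u v] ip_lower_eq[of n v u] by (simp add: ip_commute)

text \<open>Self-adjointness moves the factors across one at a time, and commutation merges them
  with those already there. Since \<open>n\<close> exceeds the total number of factors, every vector
  on the way vanishes at \<open>n\<close> and no boundary term appears.\<close>

lemma ip_word:
  assumes "k + m + k' + m' < n"
  shows "ip n (word k m) (word k' m') = ip n delta (word (k + k') (m + m'))"
  using assms
proof (induction k arbitrary: k')
  case 0
  then show ?case
  proof (induction m arbitrary: m')
    case 0
    then show ?case by (simp add: word_def)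
  next
    case (Suc m)
    have "ip n (word 0 (Suc m)) (word k' m') = ip n (word 0 m) (word k' (Suc m'))"
      unfolding lower_word[symmetric] using Suc.prems by (intro ip_lower word_vanish) auto
    then show ?case
      using Suc.IH[of "Suc m'"] Suc.prems by simp
  qed
next
  case (Suc k)
  have "ip n (word (Suc k) m) (word k' m') = ip n (word k m) (word (Suc k') m')"
    unfolding upper_word[symmetric] using Suc.prems by (intro ip_upper word_vanish) auto
  then show ?case
    using Suc.IH[of "Suc k'"] Suc.prems by simp
qed

lemma ip_upper_nonneg:
  assumes "v n = 0"
  shows "0 \<le> ip n v (upper v)"
proof -
  have "0 \<le> (\<Sum>i\<le>n. 3 * B * (v i)\<^sup>2 + 1 * (v i * T v i))"
    using tridiag_op_form_bound[of d B e 1 n v] d_bound e_bound assms by simp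
  also have "\<dots> = 6 * B * ip n v (upper v)"
    by (simp add: ip_def sum_distrib_left T_eq_upper algebra_simps power2_eq_square)
  finally show ?thesis
    using B_pos by (simp add: zero_le_mult_iff)
qed

lemma ip_lower_nonneg:
  assumes "v n = 0"
  shows "0 \<le> ip n v (lower v)"
proof -
  have "0 \<le> (\<Sum>i\<le>n. 3 * B * (v i)\<^sup>2 + (-1) * (v i * T v i))"
    using tridiag_op_form_bound[of d B e "-1" n v] d_bound e_bound assms by simp
  also have "\<dots> = 6 * B * ip n v (lower v)"
    by (simp add: ip_def sum_distrib_left T_eq_lower algebra_simps power2_eq_square)
  finally show ?thesis
    using B_pos by (simp add: zero_le_mult_iff)
qed

lemma ip_delta: "ip n delta v = v 0"
proof -
  have "ip n delta v = (\<Sum>i\<in>{..n}. if i = 0 then v i else 0)"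
    unfolding ip_def delta_def by (rule sum.cong) auto
  then show ?thesis by simp
qed

text \<open>Half of the factors are moved to the other side of the inner product. Two even exponents
  give a squared norm; one odd exponent leaves a single \<open>upper\<close> or \<open>lower\<close>
  inside a nonnegative form. Two odd exponents reduce to these cases by \<open>word_step\<close>,
  which raises either exponent to an even one.\<close>

lemma word_nonneg: "0 \<le> word k m 0"
proof -
  have ip: "word (i + i') (j + j') 0 = ip (Suc (i + j + i' + j')) (word i j) (word i' j')" for i j i' j'
    by (subst ip_word) (simp_all add: ip_delta)
  have ee: "0 \<le> word (i + i) (j + j) 0" for i j
    unfolding ip by (simp add: ip_def sum_nonneg)
  have oe: "0 \<le> word (i + Suc i) (j + j) 0" for i j
    unfolding ip upper_word[symmetric] by (rule ip_upper_nonneg) (simp add: word_vanish)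
  have eo: "0 \<le> word (i + i) (j + Suc j) 0" for i j
    unfolding ip lower_word[symmetric] by (rule ip_lower_nonneg) (simp add: word_vanish)
  have oo: "0 \<le> word (i + Suc i) (j + Suc j) 0" for i j
    using eo[of "Suc i" j] oe[of i "Suc j"] word_step[of "i + Suc i" "j + Suc j" 0] by simp
  have half: "\<exists>i. k = i + i \<or> k = i + Suc i" for k :: nat
    by (metis add_Suc_right even_iff_mod_2_eq_zero mult_2 odd_iff_mod_2_eq_one oddE evenE Suc_eq_plus1)
  obtain i j where "k = i + i \<or> k = i + Suc i" "m = j + j \<or> m = j + Suc j"
    using half by blast
  then show ?thesis
    using ee oe eo oo by blast
qed

lemma mat_power_eq: "mat_power (sym_tridiag d e) k 0 = (T ^^ k) delta"
proof (induction k)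
  case 0
  show ?case by (auto simp: delta_def fun_eq_iff)
next
  case (Suc k)
  then show ?case by (simp add: mat_power_sym_tridiag del: mat_power.simps(2))
qed

text \<open>The Hausdorff problem for the words yields a measure on [0, 1], and its image under the
  affine map onto [-3 B, 3 B] has the moments of J.\<close>

lemma ex_spectral_measure:
  "\<exists>M. is_spectral_measure (sym_tridiag d e) M \<and> (AE x in M. \<bar>x\<bar> \<le> 3 * B)"
proof -
  have one: "word 0 0 0 = 1"
    by (simp add: word_def delta_def)
  obtain N where N: "real_distribution N" and supp: "AE x in N. 0 \<le> x \<and> x \<le> 1"
    and mom: "\<And>j. (\<integral>x. x ^ j \<partial>N) = word j 0 0"
    using hausdorff_moment[of "\<lambda>k m. word k m 0", OF word_nonneg one word_step] by blast
  interpret N: real_distribution N by (rule N)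
  define f where "f x = 3 * B * (2 * x - 1)" for x
  have [measurable]: "f \<in> borel_measurable borel"
    unfolding f_def by measurable
  have f_supp: "AE x in N. \<bar>f x\<bar> \<le> 3 * B"
    using supp
  proof eventually_elim
    case (elim x)
    then have "\<bar>2 * x - 1\<bar> \<le> 1" by auto
    then show ?case
      using B_pos mult_left_mono[of "\<bar>2 * x - 1\<bar>" 1 "3 * B"] by (simp add: f_def abs_mult)
  qed
  have int: "integrable N (\<lambda>x. x ^ i * f x ^ j)" for i j
  proof (rule N.integrable_const_bound[of _ "1 * (3 * B) ^ j"])
    show "AE x in N. norm (x ^ i * f x ^ j) \<le> 1 * (3 * B) ^ j"
      using supp f_supp
    proof eventually_elim
      case (elim x)
      have "\<bar>x\<bar> ^ i * \<bar>f x\<bar> ^ j \<le> 1 * (3 * B) ^ j"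
        using elim by (intro mult_mono power_mono power_le_one) auto
      then show ?case by (simp add: abs_mult power_abs)
    qed
  qed auto
  \<comment> \<open>Replacing one factor \<open>f x\<close> by 6 B x - 3 B mirrors
    \<open>T_eq_upper\<close>. This raises the power of x, so the induction on \<open>j\<close> has
    to keep \<open>i\<close> general.\<close>
  have mixed: "(\<integral>x. x ^ i * f x ^ j \<partial>N) = (upper ^^ i) ((T ^^ j) delta) 0" for i j
  proof (induction j arbitrary: i)
    case 0
    then show ?case by (simp add: mom word_def)
  next
    case (Suc j)
    have "(\<integral>x. x ^ i * f x ^ Suc j \<partial>N) = (\<integral>x. 6 * B * (x ^ Suc i * f x ^ j) - 3 * B * (x ^ i * f x ^ j) \<partial>N)"
      by (rule Bochner_Integration.integral_cong) (simp_all add: f_def algebra_simps)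
    also have "\<dots> = 6 * B * (\<integral>x. x ^ Suc i * f x ^ j \<partial>N) - 3 * B * (\<integral>x. x ^ i * f x ^ j \<partial>N)"
      using int by (subst Bochner_Integration.integral_diff) (auto intro!: integrable_mult_right simp del: power_Suc)
    also have "\<dots> = T ((upper ^^ i) ((T ^^ j) delta)) 0"
      by (simp add: Suc.IH T_eq_upper[of "(upper ^^ i) ((T ^^ j) delta)" 0] del: power_Suc)
    also have "\<dots> = (upper ^^ i) ((T ^^ Suc j) delta) 0"
      by (simp add: T_upper_power)
    finally show ?case .
  qed
  define M where "M = distr N borel f"
  have "prob_space M"
    unfolding M_def by (rule N.prob_space_distr) simp
  moreover have "integrable M (\<lambda>x. x ^ k)" for k
    using int[of 0 k] by (simp add: M_def integrable_distr_eq)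
  moreover have "(\<integral>x. x ^ k \<partial>M) = mat_power (sym_tridiag d e) k 0 0" for k
    using mixed[of 0 k] by (simp add: M_def integral_distr mat_power_eq)
  moreover have "AE x in M. \<bar>x\<bar> \<le> 3 * B"
    unfolding M_def using f_supp by (subst AE_distr_iff) auto
  ultimately show ?thesis
    unfolding is_spectral_measure_def by (intro exI[of _ M]) (simp add: M_def)
qed

text \<open>The definite description in \<open>spectral_measure\<close> denotes the measure just
  constructed once uniqueness is known; its compact support provides the moment bound for
  that.\<close>

lemma spectral_measure:
  "is_spectral_measure (sym_tridiag d e) (spectral_measure (sym_tridiag d e))"
  "AE x in spectral_measure (sym_tridiag d e). \<bar>x\<bar> \<le> 3 * B"
proof -
  let ?J = "sym_tridiag d e"
  obtain M where M: "is_spectral_measure ?J M" and supp: "AE x in M. \<bar>x\<bar> \<le> 3 * B"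
    using ex_spectral_measure by blast
  interpret M: prob_space M
    using M by (simp add: is_spectral_measure_def)
  have bound: "(\<integral>x. x ^ (2 * k) \<partial>M) \<le> (3 * B) ^ (2 * k)" for k
  proof -
    have "(\<integral>x. x ^ (2 * k) \<partial>M) \<le> (\<integral>x. (3 * B) ^ (2 * k) \<partial>M)"
    proof (rule integral_mono_AE)
      show "AE x in M. x ^ (2 * k) \<le> (3 * B) ^ (2 * k)"
        using supp
      proof eventually_elim
        case (elim x)
        then have "\<bar>x\<bar> ^ (2 * k) \<le> (3 * B) ^ (2 * k)"
          by (intro power_mono) auto
        then show ?case by (simp add: power_even_abs)
      qed
    qed (use M in \<open>auto simp: is_spectral_measure_def\<close>)
    then show ?thesis by (simp add: M.prob_space)
  qed
  \<comment> \<open>A competitor has the same moments as \<open>M\<close>, so the growth bound for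
    \<open>M\<close> serves both.\<close>
  have "N = M" if N: "is_spectral_measure ?J N" for N
  proof -
    have "M = N"
    proof (rule real_distribution_eqI_moments[where R = "3 * B"])
      show "real_distribution M" "real_distribution N"
        using M N by (auto simp: is_spectral_measure_def real_distribution_def real_distribution_axioms_def
            dest: sets_eq_imp_space_eq)
    qed (use M N bound in \<open>auto simp: is_spectral_measure_def\<close>)
    then show ?thesis by simp
  qed
  then have eq: "spectral_measure ?J = M"
    unfolding spectral_measure_def using M by (rule the_equality[rotated])
  show "is_spectral_measure ?J (spectral_measure ?J)"
    unfolding eq by (rule M)
  show "AE x in spectral_measure ?J. \<bar>x\<bar> \<le> 3 * B"
    unfolding eq by (rule supp)
qed

end

section \<open>Integrals of binomials and the hypergeometric continuation\<close>

lemma borel_measurable_indicator_continuous: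
  fixes f :: "real \<Rightarrow> complex"
  assumes "sets M = sets borel" "compact K" "continuous_on K f"
  shows "(\<lambda>t. indicator K t *\<^sub>R f t) \<in> borel_measurable M"
  using borel_measurable_continuous_on_indicator[of K f] assms
  by (simp add: measurable_cong_sets[OF assms(1) refl] compact_imp_closed)

text \<open>Compactness bounds the integrand uniformly near a point, Cauchy's inequality then bounds
  its derivatives and hence its difference quotients, and dominated convergence takes the derivative
  under the integral.\<close>

lemma holomorphic_on_integral_compact:
  fixes f :: "complex \<Rightarrow> real \<Rightarrow> complex"
  assumes "finite_measure M" and sets: "sets M = sets borel"
    and K: "compact K" and S: "open S"
    and cont: "continuous_on (S \<times> K) (\<lambda>(w, t). f w t)"
    and holo: "\<And>t. t \<in> K \<Longrightarrow> (\<lambda>w. f w t) holomorphic_on S"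
  shows "(\<lambda>w. LINT t:K|M. f w t) holomorphic_on S"
proof -
  interpret finite_measure M by fact
  define F where "F w t = indicator K t *\<^sub>R f w t" for w t
  have F_meas: "F w \<in> borel_measurable M" if "w \<in> S" for w
    unfolding F_def
  proof (rule borel_measurable_indicator_continuous[OF sets K])
    have "continuous_on K ((\<lambda>(w, t). f w t) \<circ> (\<lambda>t. (w, t)))"
      by (intro continuous_on_compose continuous_intros continuous_on_subset[OF cont]) (use that in auto)
    then show "continuous_on K (f w)" by (simp add: o_def)
  qed
  have F_holo: "(\<lambda>w. F w t) holomorphic_on S" for t
    unfolding F_def by (cases "t \<in> K") (use holo in auto)
  have deriv_int: "\<exists>D. ((\<lambda>w. \<integral>t. F w t \<partial>M) has_field_derivative D) (at w0)" if w0: "w0 \<in> S" for w0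
  proof -
    obtain r where r: "0 < r" "cball w0 r \<subseteq> S"
      using S w0 open_contains_cball by blast
    have "compact ((\<lambda>(w, t). f w t) ` (cball w0 r \<times> K))"
      by (intro compact_continuous_image continuous_on_subset[OF cont] compact_Times K) (use r in auto)
    then obtain C where C: "\<And>x. x \<in> (\<lambda>(w, t). f w t) ` (cball w0 r \<times> K) \<Longrightarrow> norm x \<le> C"
      using compact_imp_bounded bounded_iff by metis
    define B where "B = max C 0"
    have F_bound: "norm (F w t) \<le> B" if "w \<in> cball w0 r" for w t
    proof (cases "t \<in> K")
      case True
      with that have "norm (f w t) \<le> C"
        by (intro C) force
      with True show ?thesis by (simp add: F_def B_def)
    qed (simp add: F_def B_def)
    have integrable_F: "integrable M (F w)" if "w \<in> cball w0 r" for w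
      using F_bound[OF that] F_meas[of w] that r by (intro integrable_const_bound[of _ B]) auto
    \<comment> \<open>Half the radius, so that the discs of radius r / 2 used in Cauchy's inequality
      stay inside \<open>cball w0 r\<close>.\<close>
    define U where "U = ball w0 (r / 2)"
    have U: "convex U" "open U" "w0 \<in> U" "U \<subseteq> S" "U \<subseteq> cball w0 r"
    proof -
      show "U \<subseteq> cball w0 r" using r by (auto simp: U_def)
      then show "U \<subseteq> S" using r by auto
    qed (use r in \<open>auto simp: U_def\<close>)
    have F_deriv: "((\<lambda>w. F w t) has_field_derivative deriv (\<lambda>w. F w t) w) (at w)" if "w \<in> S" for w t
      using holomorphic_derivI[OF F_holo S that] .
    have deriv_bound: "norm (deriv (\<lambda>w. F w t) w) \<le> B / (r / 2)" if "w \<in> U" for w t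
    proof -
      have sub: "cball w (r / 2) \<subseteq> cball w0 r"
      proof
        fix x assume "x \<in> cball w (r / 2)"
        then show "x \<in> cball w0 r"
          using that dist_triangle[of w0 x w] by (simp add: U_def)
      qed
      have "norm ((deriv ^^ 1) (\<lambda>w. F w t) w) \<le> fact 1 * B / (r / 2) ^ 1"
      proof (rule Cauchy_inequality)
        show "(\<lambda>w. F w t) holomorphic_on ball w (r / 2)"
          by (rule holomorphic_on_subset[OF F_holo]) (use sub r ball_subset_cball in blast)
        show "continuous_on (cball w (r / 2)) (\<lambda>w. F w t)"
          by (rule holomorphic_on_imp_continuous_on[OF holomorphic_on_subset[OF F_holo]]) (use sub r in blast)
        show "0 < r / 2" using r by simp
        show "norm (F x t) \<le> B" if "norm (w - x) = r / 2" for x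
          by (rule F_bound, rule subsetD[OF sub]) (use that in \<open>simp add: dist_norm\<close>)
      qed
      then show ?thesis by simp
    qed
    have lipschitz: "norm (F w t - F w0 t) \<le> B / (r / 2) * norm (w - w0)" if "w \<in> U" for w t
      by (rule field_differentiable_bound[OF U(1)])
         (use F_deriv U that deriv_bound in \<open>auto intro: DERIV_subset\<close>)
    define G where "G t = deriv (\<lambda>w. F w t) w0" for t
    have quotient_lim: "(\<lambda>n. (F (X n) t - F w0 t) / (X n - w0)) \<longlonglongrightarrow> G t"
      if "\<And>i. X i \<in> U - {w0}" "X \<longlonglongrightarrow> w0" for X t
    proof -
      have "((\<lambda>w. (F w t - F w0 t) / (w - w0)) \<longlongrightarrow> G t) (at w0 within U)"
        using F_deriv[OF w0, of t, THEN DERIV_subset[of _ _ _ _ U]] by (simp add: has_field_derivative_iff G_def)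
      then show ?thesis
        unfolding tendsto_at_iff_sequentially using that by (simp add: o_def)
    qed
    have X_meas: "(\<lambda>t. (F (X n) t - F w0 t) / (X n - w0)) \<in> borel_measurable M"
      if "\<And>i. X i \<in> U - {w0}" for X n
      using F_meas[of "X n"] F_meas[OF w0] that[of n] U by auto
    have quotient_bound: "norm ((F w t - F w0 t) / (w - w0)) \<le> B / (r / 2)" if "w \<in> U - {w0}" for w t
      using lipschitz[of w t] that r by (simp add: norm_divide divide_simps)
    have G_meas: "G \<in> borel_measurable M"
    proof -
      \<comment> \<open>Some sequence in the punctured disc tending to \<open>w0\<close>, to exhibit
        \<open>G\<close> as a pointwise limit of measurable functions; r / 3 keeps it within radius
        r / 2.\<close>
      define X where "X n = w0 + of_real (r / 3 / real (Suc n))" for n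
      have "r / 3 / real (Suc n) < r / 2" for n
        using r by (auto simp: divide_simps intro: add_pos_nonneg)
      then have X: "X i \<in> U - {w0}" for i
        using r by (auto simp: X_def U_def dist_norm norm_divide simp flip: of_real_divide)
      have "(\<lambda>n. r / 3 / real (Suc n)) \<longlonglongrightarrow> 0"
        by real_asymp
      then have "X \<longlonglongrightarrow> w0 + of_real 0"
        unfolding X_def by (intro tendsto_intros)
      then have lim: "X \<longlonglongrightarrow> w0" by simp
      show ?thesis
        by (rule borel_measurable_LIMSEQ_metric[where f = "\<lambda>n t. (F (X n) t - F w0 t) / (X n - w0)"])
           (use X_meas[OF X] quotient_lim[OF X lim] in auto)
    qed
    have "((\<lambda>w. ((\<integral>t. F w t \<partial>M) - (\<integral>t. F w0 t \<partial>M)) / (w - w0)) \<longlongrightarrow> (\<integral>t. G t \<partial>M)) (at w0 within U)"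
      unfolding tendsto_at_iff_sequentially
    proof (intro allI impI)
      fix X assume X: "\<forall>i. X i \<in> U - {w0}" and lim: "X \<longlonglongrightarrow> w0"
      have "(\<lambda>n. \<integral>t. (F (X n) t - F w0 t) / (X n - w0) \<partial>M) \<longlonglongrightarrow> (\<integral>t. G t \<partial>M)"
      proof (rule integral_dominated_convergence[where w = "\<lambda>_. B / (r / 2)"])
        show "AE t in M. (\<lambda>n. (F (X n) t - F w0 t) / (X n - w0)) \<longlonglongrightarrow> G t"
          using quotient_lim X lim by auto
        show "AE t in M. norm ((F (X n) t - F w0 t) / (X n - w0)) \<le> B / (r / 2)" for n
          using quotient_bound X by blast
        show "(\<lambda>t. (F (X n) t - F w0 t) / (X n - w0)) \<in> borel_measurable M" for n
          using X by (intro X_meas) auto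
      qed (use G_meas in auto)
      moreover have "(\<integral>t. (F (X n) t - F w0 t) / (X n - w0) \<partial>M) =
          ((\<integral>t. F (X n) t \<partial>M) - (\<integral>t. F w0 t \<partial>M)) / (X n - w0)" for n
        using integrable_F[of "X n"] integrable_F[of w0] X U by (auto simp: subset_iff)
      ultimately show "((\<lambda>w. ((\<integral>t. F w t \<partial>M) - (\<integral>t. F w0 t \<partial>M)) / (w - w0)) \<circ> X) \<longlonglongrightarrow> (\<integral>t. G t \<partial>M)"
        by (simp only: o_def)
    qed
    then show ?thesis
      unfolding has_field_derivative_iff at_within_open[OF U(3) U(2)] by (rule exI)
  qed
  then show ?thesis
    using S unfolding set_lebesgue_integral_def F_def[symmetric]
    by (auto simp: holomorphic_on_open)
qed

text \<open>One kernel for two purposes: exponent 1 against the spectral measure gives the Stieltjes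
  transform up to the factor - w, and a general exponent against a beta distribution gives Euler's
  integral. On a compact set where the base avoids the branch cut the integrand is
  continuous.\<close>

definition binomial_integral :: "complex \<Rightarrow> real set \<Rightarrow> real measure \<Rightarrow> complex \<Rightarrow> complex" where
  "binomial_integral \<alpha> K M w = (LINT t:K|M. (1 - w * of_real t) powr (- \<alpha>))"

lemma binomial_integral_holomorphic:
  assumes "finite_measure M" "sets M = sets borel" "compact K" "open S"
    and S: "\<And>w t. w \<in> S \<Longrightarrow> t \<in> K \<Longrightarrow> 1 - w * of_real t \<notin> \<real>\<^sub>\<le>\<^sub>0"
  shows "binomial_integral \<alpha> K M holomorphic_on S"
proof -
  have "continuous_on (S \<times> K) (\<lambda>x. (1 - fst x * of_real (snd x)) powr (- \<alpha>))"
  proof (intro continuous_intros subsetI)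
    fix x assume "x \<in> S \<times> K"
    then have "1 - fst x * of_real (snd x) \<notin> \<real>\<^sub>\<le>\<^sub>0"
      using S by auto
    then show "x \<in> {z. 0 \<le> Re (1 - fst z * of_real (snd z)) \<or> Im (1 - fst z * of_real (snd z)) \<noteq> 0}"
      by (auto simp: complex_nonpos_Reals_iff)
  next
    fix x assume "x \<in> S \<times> K" "1 - fst x * complex_of_real (snd x) = 0"
    then show "0 < Re (- \<alpha>)"
      using S[of "fst x" "snd x"] by auto
  qed
  then have "continuous_on (S \<times> K) (\<lambda>(w, t). (1 - w * of_real t) powr (- \<alpha>))"
    by (simp add: case_prod_unfold)
  then show ?thesis
    unfolding binomial_integral_def using assms
    by (intro holomorphic_on_integral_compact) (auto intro!: holomorphic_intros)
qed

text \<open>On \<open>K\<close> the binomial series is dominated by the absolutely convergent series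
  at \<open>norm w * R\<close>, so it may be integrated term by term.\<close>

lemma binomial_integral_sums:
  assumes "finite_measure M" and sets: "sets M = sets borel" and K: "compact K" "K \<subseteq> {-R..R}"
    and w: "norm w * R < 1"
  shows "(\<lambda>k. pochhammer \<alpha> k / fact k * of_real (LINT t:K|M. t ^ k) * w ^ k) sums binomial_integral \<alpha> K M w"
\<comment> \<open>For nonempty \<open>K\<close> the inclusion in \<open>{-R..R}\<close> forces
  \<open>0 \<le> R\<close>.\<close>
proof (cases "K = {}")
  case True
  then show ?thesis
    by (simp add: binomial_integral_def set_lebesgue_integral_def)
next
  case False
  interpret finite_measure M by fact
  have "0 \<le> R"
    using False K by (force simp: subset_iff)
  define a where "a k = ((- \<alpha>) gchoose k)" for k
  define g where "g k t = indicator K t *\<^sub>R (a k * (- w * of_real t) ^ k)" for k and t :: real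
  have small: "norm (- w * of_real t) \<le> norm w * R" if "t \<in> K" for t :: real
  proof -
    have "\<bar>t\<bar> \<le> R"
      using that K(2) by (fastforce simp: abs_le_iff)
    then show ?thesis
      by (simp add: norm_mult mult_left_mono)
  qed
  have abs_sum: "summable (\<lambda>k. norm (a k * of_real (norm w * R) ^ k))"
    unfolding a_def
    by (rule abs_summable_in_conv_radius) (use w \<open>0 \<le> R\<close> in \<open>auto simp: conv_radius_gchoose norm_mult one_ereal_def\<close>)
  have g_bound: "norm (g k t) \<le> norm (a k * of_real (norm w * R) ^ k)" for k t
  proof (cases "t \<in> K")
    case True
    have "norm (- w * of_real t) ^ k \<le> (norm w * R) ^ k"
      using small[OF True] by (intro power_mono) auto
    then show ?thesis
      using True \<open>0 \<le> R\<close> by (simp add: g_def norm_mult norm_power mult_left_mono)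
  qed (simp add: g_def)
  have g_meas: "g k \<in> borel_measurable M" for k
    unfolding g_def by (rule borel_measurable_indicator_continuous[OF sets K(1)]) (intro continuous_intros)
  have g_int: "integrable M (g k)" for k
    using g_bound g_meas by (intro integrable_const_bound[of _ "norm (a k * of_real (norm w * R) ^ k)"]) auto
  have sums_g: "(\<lambda>k. g k t) sums (indicator K t *\<^sub>R ((1 - w * of_real t) powr (- \<alpha>)))" for t
  proof (cases "t \<in> K")
    case True
    have "norm (- w * of_real t) < 1"
      using small[OF True] w by linarith
    from gen_binomial_complex[OF this, of "- \<alpha>"] True show ?thesis
      by (simp add: g_def a_def)
  qed (simp add: g_def)
  have "(\<lambda>k. \<integral>t. g k t \<partial>M) sums (\<integral>t. (\<Sum>k. g k t) \<partial>M)"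
  proof (rule sums_integral[OF g_int])
    show "AE t in M. summable (\<lambda>k. norm (g k t))"
      using g_bound by (intro AE_I2 summable_comparison_test[OF _ abs_sum]) auto
    show "summable (\<lambda>k. \<integral>t. norm (g k t) \<partial>M)"
    proof (rule summable_comparison_test[OF _ summable_mult[OF abs_sum, of "measure M (space M)"]], intro exI allI impI)
      fix k
      have "(\<integral>t. norm (g k t) \<partial>M) \<le> (\<integral>t. norm (a k * of_real (norm w * R) ^ k) \<partial>M)"
        using g_int g_bound by (intro integral_mono) auto
      then show "norm (\<integral>t. norm (g k t) \<partial>M) \<le> measure M (space M) * norm (a k * of_real (norm w * R) ^ k)"
        by simp
    qed
  qed
  moreover have "(\<integral>t. (\<Sum>k. g k t) \<partial>M) = binomial_integral \<alpha> K M w"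
    unfolding binomial_integral_def set_lebesgue_integral_def by (simp only: sums_unique[OF sums_g])
  moreover have "(\<integral>t. g k t \<partial>M) = pochhammer \<alpha> k / fact k * of_real (LINT t:K|M. t ^ k) * w ^ k" for k
  proof -
    have "(\<integral>t. g k t \<partial>M) = (\<integral>t. pochhammer \<alpha> k / fact k * w ^ k * of_real (indicator K t *\<^sub>R t ^ k) \<partial>M)"
    proof (rule Bochner_Integration.integral_cong[OF refl])
      fix t
      have "(- 1) ^ k * (- w * of_real t) ^ k = (w * of_real t) ^ k"
        by (simp flip: power_mult_distrib)
      then have "a k * (- w * of_real t) ^ k = pochhammer \<alpha> k / fact k * (w * of_real t) ^ k"
        unfolding a_def gbinomial_pochhammer by simp
      then show "g k t = pochhammer \<alpha> k / fact k * w ^ k * of_real (indicator K t *\<^sub>R t ^ k)"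
        by (simp add: g_def power_mult_distrib indicator_def)
    qed
    also have "\<dots> = pochhammer \<alpha> k / fact k * w ^ k * of_real (LINT t:K|M. t ^ k)"
      by (simp add: set_lebesgue_integral_def del: of_real_mult of_real_power)
    finally show ?thesis by simp
  qed
  ultimately show ?thesis by simp
qed

lemma binomial_integral_has_fps_expansion:
  assumes "finite_measure M" "sets M = sets borel" "compact K" "K \<subseteq> {-R..R}" "0 < R"
  shows "binomial_integral \<alpha> K M has_fps_expansion
    Abs_fps (\<lambda>k. pochhammer \<alpha> k / fact k * of_real (LINT t:K|M. t ^ k))"
proof (rule has_fps_expansionI)
  have "\<forall>\<^sub>F w in nhds 0. w \<in> ball 0 (1 / R)"
    using assms by (intro eventually_nhds_in_open) auto
  then show "\<forall>\<^sub>F w in nhds 0. (\<lambda>k. fps_nth (Abs_fps (\<lambda>k. pochhammer \<alpha> k / fact k *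
      of_real (LINT t:K|M. t ^ k))) k * w ^ k) sums binomial_integral \<alpha> K M w"
  proof eventually_elim
    case (elim w)
    then show ?case
      using binomial_integral_sums[OF assms(1-4), of w \<alpha>] assms(5) by (simp add: field_simps)
  qed
qed

text \<open>The measure is the beta distribution, so \<open>binomial_integral\<close> against it is Euler's integral.\<close>

lemma pochhammer_ratio_moments:
  fixes \<beta> \<gamma> :: real
  assumes "0 < \<beta>" "\<beta> < \<gamma>"
  obtains M where "real_distribution M" "AE t in M. t \<in> {0..1}"
    "\<And>k. (\<integral>t. t ^ k \<partial>M) = pochhammer \<beta> k / pochhammer \<gamma> k"
proof -
  \<comment> \<open>The integral of t^k (1 - t)^m against the beta distribution with parameters
    \<beta> and \<gamma> - \<beta>.\<close>
  define A where "A k m = pochhammer \<beta> k * pochhammer (\<gamma> - \<beta>) m / pochhammer \<gamma> (k + m)" for k m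
  have A_pos: "0 \<le> A k m" for k m
    using assms by (auto simp: A_def intro!: divide_nonneg_nonneg mult_nonneg_nonneg pochhammer_nonneg)
  have A_step: "A k m = A (Suc k) m + A k (Suc m)" for k m
  proof -
    have "0 < pochhammer \<gamma> (k + m)" "0 < \<gamma> + real (k + m)"
      using assms by (auto intro!: pochhammer_pos add_pos_nonneg)
    then show ?thesis
      by (simp add: A_def pochhammer_Suc divide_simps) (simp add: algebra_simps)
  qed
  show thesis
    by (rule hausdorff_moment[of A, OF A_pos _ A_step]) (use that in \<open>auto simp: A_def\<close>)
qed

text \<open>For t in [0, 1] the base 1 - w t meets the branch cut only if w is real and at least 1,
  so Euler's integral is holomorphic on the cut plane and is the required continuation. The upper
  parameters have different roles: the integrated one lies between 0 and \<gamma>, while \<alpha> is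
  arbitrary, which admits a parameter \<open>c \<le> 0\<close>.\<close>

lemma hypergeo_2F1_props:
  fixes \<beta> \<gamma> :: real
  assumes "0 < \<beta>" "\<beta> < \<gamma>"
  shows hypergeo_2F1_holomorphic:
      "hypergeo_2F1 \<alpha> (of_real \<beta>) (of_real \<gamma>) holomorphic_on cut_plane" (is ?holo)
    and hypergeo_2F1_has_fps_expansion: "hypergeo_2F1 \<alpha> (of_real \<beta>) (of_real \<gamma>)
      has_fps_expansion fps_hypergeo [\<alpha>, of_real \<beta>] [of_real \<gamma>] 1" (is ?fps)
proof -
  obtain M where "real_distribution M" and supp: "AE t in M. t \<in> {0..1}"
    and mom: "\<And>k. (\<integral>t. t ^ k \<partial>M) = pochhammer \<beta> k / pochhammer \<gamma> k"
    using pochhammer_ratio_moments[OF assms] by blast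
  interpret real_distribution M by fact
  define f where "f = binomial_integral \<alpha> {0..1} M"
  have mom': "(LINT t:{0..1}|M. t ^ k) = pochhammer \<beta> k / pochhammer \<gamma> k" for k
  proof -
    have "(LINT t:{0..1}|M. t ^ k) = (\<integral>t. t ^ k \<partial>M)"
      unfolding set_lebesgue_integral_def
    proof (rule integral_cong_AE)
      show "AE t in M. indicator {0..1} t *\<^sub>R t ^ k = t ^ k"
        using supp by eventually_elim auto
    qed auto
    then show ?thesis by (simp add: mom)
  qed
  have holo: "f holomorphic_on cut_plane"
    unfolding f_def
  proof (rule binomial_integral_holomorphic)
    fix w :: complex and t :: real
    assume w: "w \<in> cut_plane" and t: "t \<in> {0..1}"
    show "1 - w * of_real t \<notin> \<real>\<^sub>\<le>\<^sub>0"
    proof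
      assume "1 - w * of_real t \<in> \<real>\<^sub>\<le>\<^sub>0"
      then have *: "1 \<le> Re w * t" "Im w * t = 0"
        by (auto simp: complex_nonpos_Reals_iff)
      then have "t \<noteq> 0" by auto
      with * have "Im w = 0" by simp
      moreover have "0 < Re w"
        using * t by (smt (verit) mult_nonpos_nonneg atLeastAtMost_iff)
      then have "Re w * t \<le> Re w"
        using t by (intro mult_left_le) auto
      ultimately show False
        using * w by (auto simp: cut_plane_def)
    qed
  qed (use open_cut_plane finite_measure_axioms in auto)
  have "f w = eval_fps (fps_hypergeo [\<alpha>, of_real \<beta>] [of_real \<gamma>] 1) w" if "w \<in> ball 0 1" for w
  proof -
    have "(\<lambda>k. pochhammer \<alpha> k / fact k * of_real (LINT t:{0..1}|M. t ^ k) * w ^ k) sums f w"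
      unfolding f_def by (rule binomial_integral_sums[where R = 1]) (use that finite_measure_axioms in auto)
    then have "f w = (\<Sum>k. pochhammer \<alpha> k / fact k * of_real (LINT t:{0..1}|M. t ^ k) * w ^ k)"
      by (rule sums_unique)
    also have "\<dots> = eval_fps (fps_hypergeo [\<alpha>, of_real \<beta>] [of_real \<gamma>] 1) w"
      by (simp add: eval_fps_def mom' pochhammer_of_real mult_ac)
    finally show ?thesis .
  qed
  with holo have f: "hypergeo_2F1_continuation \<alpha> (of_real \<beta>) (of_real \<gamma>) f"
    by (simp add: hypergeo_2F1_continuation_def)
  have eq: "hypergeo_2F1 \<alpha> (of_real \<beta>) (of_real \<gamma>) w = f w" if "w \<in> cut_plane" for w
    by (rule hypergeo_2F1_eqI[OF f that])
  show ?holo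
    using holo eq by (metis holomorphic_transform)
  have "f has_fps_expansion Abs_fps (\<lambda>k. pochhammer \<alpha> k / fact k * of_real (LINT t:{0..1}|M. t ^ k))"
    unfolding f_def
    by (rule binomial_integral_has_fps_expansion[where R = 1]) (use finite_measure_axioms in auto)
  also have "Abs_fps (\<lambda>k. pochhammer \<alpha> k / fact k * of_real (LINT t:{0..1}|M. t ^ k)) =
      fps_hypergeo [\<alpha>, of_real \<beta>] [of_real \<gamma>] 1"
    by (simp add: fps_eq_iff mom' pochhammer_of_real mult_ac)
  finally have "f has_fps_expansion fps_hypergeo [\<alpha>, of_real \<beta>] [of_real \<gamma>] 1" .
  moreover have "\<forall>\<^sub>F w in nhds 0. f w = hypergeo_2F1 \<alpha> (of_real \<beta>) (of_real \<gamma>) w"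
  proof (rule eventually_mono)
    show "\<forall>\<^sub>F w in nhds 0. w \<in> cut_plane"
      by (rule eventually_nhds_in_open[OF open_cut_plane]) (simp add: cut_plane_def)
  qed (simp add: eq)
  ultimately show ?fps
    using has_fps_expansion_cong by blast
qed

section \<open>Contiguous relations\<close>

unbundle no vec_syntax

definition hg :: "'a \<Rightarrow> 'a \<Rightarrow> 'a \<Rightarrow> 'a::field_char_0 fps" where
  "hg \<alpha> \<beta> \<gamma> = fps_hypergeo [\<alpha>, \<beta>] [\<gamma>] 1"

lemma hg_commute: "hg \<alpha> \<beta> \<gamma> = hg \<beta> \<alpha> \<gamma>"
  by (simp add: hg_def fps_eq_iff mult_ac)

lemma hg_nth: "hg \<alpha> \<beta> \<gamma> $ k = pochhammer \<alpha> k * pochhammer \<beta> k / (pochhammer \<gamma> k * fact k)"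
  by (simp add: hg_def)

context
  fixes \<alpha> \<beta> \<gamma> :: "'a::field_char_0"
  assumes \<gamma>: "\<And>n. \<gamma> + of_nat n \<noteq> 0"
begin

lemma \<gamma>_0: "\<gamma> \<noteq> 0" and \<gamma>_1: "\<gamma> + 1 \<noteq> 0"
  using \<gamma>[of 0] \<gamma>[of 1] by simp_all

lemma pochhammer_\<gamma>: "pochhammer \<gamma> k \<noteq> 0"
proof
  assume "pochhammer \<gamma> k = 0"
  then obtain m where "\<gamma> = - of_nat m"
    by (auto simp: pochhammer_eq_0_iff)
  then show False
    using \<gamma>[of m] by simp
qed

lemma pochhammer_\<gamma>1: "pochhammer (\<gamma> + 1) k \<noteq> 0"
  using pochhammer_\<gamma>[of "Suc k"] by (simp add: pochhammer_rec)

lemma pochhammer_\<gamma>2: "pochhammer (\<gamma> + 2) k \<noteq> 0"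
  using pochhammer_\<gamma>[of "Suc (Suc k)"] by (simp add: pochhammer_rec add.assoc)

lemma \<gamma>_Suc: "\<gamma> + 1 + of_nat k \<noteq> 0"
  using \<gamma>[of "Suc k"] by (simp add: add_ac)

lemma pochhammer_\<gamma>_Suc:
  "pochhammer \<gamma> (Suc k) = \<gamma> * (\<gamma> + 1) * pochhammer (\<gamma> + 2) k / (\<gamma> + 1 + of_nat k)"
proof -
  have "pochhammer \<gamma> (Suc (Suc k)) = \<gamma> * ((\<gamma> + 1) * pochhammer (\<gamma> + 2) k)"
    by (simp add: pochhammer_rec add.assoc)
  then have "pochhammer \<gamma> (Suc k) * (\<gamma> + 1 + of_nat k) = \<gamma> * ((\<gamma> + 1) * pochhammer (\<gamma> + 2) k)"
    by (simp add: pochhammer_Suc[of _ "Suc k"] add_ac)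
  then show ?thesis
    using \<gamma>_Suc[of k] by (simp add: divide_simps mult_ac)
qed

text \<open>At \<open>Suc k\<close> all three coefficients share the factor (\<alpha> + 1)_k
  (\<beta> + 1)_k / ((\<gamma> + 2)_k k!), which leaves a rational identity in k. This is the
  relation behind Gauss's continued fraction.\<close>

lemma hg_gauss:
  "hg \<alpha> \<beta> \<gamma> = hg \<alpha> (\<beta> + 1) (\<gamma> + 1) -
     fps_const (\<alpha> * (\<gamma> - \<beta>) / (\<gamma> * (\<gamma> + 1))) * (fps_X * hg (\<alpha> + 1) (\<beta> + 1) (\<gamma> + 2))"
proof (rule fps_ext)
  fix n
  show "hg \<alpha> \<beta> \<gamma> $ n = (hg \<alpha> (\<beta> + 1) (\<gamma> + 1) -
     fps_const (\<alpha> * (\<gamma> - \<beta>) / (\<gamma> * (\<gamma> + 1))) * (fps_X * hg (\<alpha> + 1) (\<beta> + 1) (\<gamma> + 2))) $ n"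
  proof (cases n)
    case (Suc k)
    define A B C f where "A = pochhammer (\<alpha> + 1) k" and "B = pochhammer (\<beta> + 1) k"
      and "C = pochhammer (\<gamma> + 2) k" and "f = (fact k :: 'a)"
    have nz: "C \<noteq> 0" "f \<noteq> 0" "1 + of_nat k \<noteq> (0::'a)"
      using pochhammer_\<gamma>2[of k] of_nat_neq_0[of k, where 'a = 'a] by (simp_all add: C_def f_def)
    have lhs: "hg \<alpha> \<beta> \<gamma> $ n = \<alpha> * A * (\<beta> * B) * (\<gamma> + 1 + of_nat k) / (\<gamma> * (\<gamma> + 1) * C * ((1 + of_nat k) * f))"
      using \<gamma>_Suc[of k] by (simp add: Suc hg_nth pochhammer_\<gamma>_Suc A_def B_def C_def f_def pochhammer_rec[of \<alpha>]
          pochhammer_rec[of \<beta>] divide_simps)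
    have r1: "hg \<alpha> (\<beta> + 1) (\<gamma> + 1) $ n = \<alpha> * A * (B * (\<beta> + 1 + of_nat k)) / ((\<gamma> + 1) * C * ((1 + of_nat k) * f))"
      by (simp add: Suc hg_nth A_def B_def C_def f_def pochhammer_rec[of \<alpha>] pochhammer_rec[of "\<gamma> + 1"]
          pochhammer_Suc[of "\<beta> + 1"] add.assoc)
    have r2: "hg (\<alpha> + 1) (\<beta> + 1) (\<gamma> + 2) $ k = A * B / (C * f)"
      by (simp add: hg_nth A_def B_def C_def f_def)
    show ?thesis
      using \<gamma>_0 \<gamma>_1 nz unfolding fps_sub_nth fps_mult_left_const_nth lhs r1
      by (simp add: Suc r2 divide_simps) (simp add: algebra_simps)
  qed (simp add: hg_nth)
qed

text \<open>Again a common factor leaves a rational identity in k. Here \<gamma> stays fixed in the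
  leading term, which is what the exceptional first row of Model III calls for.\<close>

lemma hg_shift:
  "hg \<alpha> \<beta> \<gamma> = hg (\<alpha> + 1) \<beta> \<gamma> - fps_const (\<beta> / \<gamma>) * (fps_X * hg (\<alpha> + 1) (\<beta> + 1) (\<gamma> + 1))"
proof (rule fps_ext)
  fix n
  show "hg \<alpha> \<beta> \<gamma> $ n =
    (hg (\<alpha> + 1) \<beta> \<gamma> - fps_const (\<beta> / \<gamma>) * (fps_X * hg (\<alpha> + 1) (\<beta> + 1) (\<gamma> + 1))) $ n"
  proof (cases n)
    case (Suc k)
    define A B C f where "A = pochhammer (\<alpha> + 1) k" and "B = pochhammer (\<beta> + 1) k"
      and "C = pochhammer (\<gamma> + 1) k" and "f = (fact k :: 'a)"
    have nz: "C \<noteq> 0" "f \<noteq> 0" "1 + of_nat k \<noteq> (0::'a)"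
      using pochhammer_\<gamma>1[of k] of_nat_neq_0[of k, where 'a = 'a] by (simp_all add: C_def f_def)
    have lhs: "hg \<alpha> \<beta> \<gamma> $ n = \<alpha> * A * (\<beta> * B) / (\<gamma> * C * ((1 + of_nat k) * f))"
      by (simp add: Suc hg_nth A_def B_def C_def f_def pochhammer_rec)
    have r1: "hg (\<alpha> + 1) \<beta> \<gamma> $ n = A * (\<alpha> + 1 + of_nat k) * (\<beta> * B) / (\<gamma> * C * ((1 + of_nat k) * f))"
      by (simp add: Suc hg_nth A_def B_def C_def f_def pochhammer_rec[of \<beta>] pochhammer_rec[of \<gamma>]
          pochhammer_Suc[of "\<alpha> + 1"])
    have r2: "hg (\<alpha> + 1) (\<beta> + 1) (\<gamma> + 1) $ k = A * B / (C * f)"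
      by (simp add: hg_nth A_def B_def C_def f_def)
    show ?thesis
      using \<gamma>_0 nz unfolding fps_sub_nth fps_mult_left_const_nth lhs r1
      by (simp add: Suc r2 divide_simps) (simp add: algebra_simps)
  qed (simp add: hg_nth)
qed

section \<open>First-order differential relations between contiguous series\<close>

lemma hg_nth_Suc:
  "hg \<alpha> \<beta> \<gamma> $ Suc k = (\<alpha> + of_nat k) * (\<beta> + of_nat k) / ((\<gamma> + of_nat k) * (1 + of_nat k)) * hg \<alpha> \<beta> \<gamma> $ k"
  by (simp add: hg_nth pochhammer_Suc mult_ac)

text \<open>The Euler operator multiplies coefficient n by n, and raising \<alpha> multiplies it by
  (\<alpha> + n) / \<alpha>. In Model III this expresses D' through D and N.\<close>

lemma hg_deriv_shift:
  "fps_X * fps_deriv (hg \<alpha> \<beta> \<gamma>) = fps_const (- \<alpha>) * hg \<alpha> \<beta> \<gamma> + fps_const \<alpha> * hg (\<alpha> + 1) \<beta> \<gamma>"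
proof (rule fps_ext)
  fix n
  have "\<alpha> * pochhammer (\<alpha> + 1) n = (\<alpha> + of_nat n) * pochhammer \<alpha> n"
    using pochhammer_rec[of \<alpha> n] pochhammer_Suc[of \<alpha> n] by (simp add: mult_ac)
  then have "\<alpha> * hg (\<alpha> + 1) \<beta> \<gamma> $ n = (\<alpha> + of_nat n) * hg \<alpha> \<beta> \<gamma> $ n"
    by (simp add: hg_nth)
  then show "(fps_X * fps_deriv (hg \<alpha> \<beta> \<gamma>)) $ n =
      (fps_const (- \<alpha>) * hg \<alpha> \<beta> \<gamma> + fps_const \<alpha> * hg (\<alpha> + 1) \<beta> \<gamma>) $ n"
  proof (cases n)
    case (Suc k)
    then show ?thesis
      using \<open>\<alpha> * hg (\<alpha> + 1) \<beta> \<gamma> $ n = _\<close> by (simp add: algebra_simps)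
  qed (simp add: hg_nth)
qed

text \<open>Raising \<alpha> and \<gamma> multiplies coefficient n by (\<alpha> + n) / (\<gamma> +
  n) up to a constant. In Model II this expresses D' through D and N.\<close>

lemma hg_deriv_shift_both:
  "(1 - fps_X) * fps_deriv (hg \<alpha> \<beta> \<gamma>) =
     fps_const \<alpha> * hg \<alpha> \<beta> \<gamma> + fps_const (- \<alpha> * (\<gamma> - \<beta>) / \<gamma>) * hg (\<alpha> + 1) \<beta> (\<gamma> + 1)"
proof (rule fps_ext)
  fix n
  have "\<alpha> * pochhammer (\<alpha> + 1) n = (\<alpha> + of_nat n) * pochhammer \<alpha> n"
    using pochhammer_rec[of \<alpha> n] pochhammer_Suc[of \<alpha> n] by (simp add: mult_ac)
  moreover have "\<gamma> * pochhammer (\<gamma> + 1) n = (\<gamma> + of_nat n) * pochhammer \<gamma> n"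
    using pochhammer_rec[of \<gamma> n] pochhammer_Suc[of \<gamma> n] by (simp add: mult_ac)
  ultimately have "\<alpha> * pochhammer (\<alpha> + 1) n * pochhammer \<beta> n / (\<gamma> * pochhammer (\<gamma> + 1) n * fact n) =
      (\<alpha> + of_nat n) / (\<gamma> + of_nat n) * (pochhammer \<alpha> n * pochhammer \<beta> n / (pochhammer \<gamma> n * fact n))"
    by (simp add: mult_ac)
  then have eq: "\<alpha> / \<gamma> * hg (\<alpha> + 1) \<beta> (\<gamma> + 1) $ n = (\<alpha> + of_nat n) / (\<gamma> + of_nat n) * hg \<alpha> \<beta> \<gamma> $ n"
    by (simp add: hg_nth mult_ac)
  have nz: "1 + of_nat n \<noteq> (0::'a)"
    using of_nat_neq_0[of n, where 'a = 'a] by simp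
  have "((1 - fps_X) * fps_deriv (hg \<alpha> \<beta> \<gamma>)) $ n = (1 + of_nat n) * hg \<alpha> \<beta> \<gamma> $ Suc n - of_nat n * hg \<alpha> \<beta> \<gamma> $ n"
    by (cases n) (simp_all add: left_diff_distrib)
  also have "\<dots> = ((\<alpha> + of_nat n) * (\<beta> + of_nat n) / (\<gamma> + of_nat n) - of_nat n) * hg \<alpha> \<beta> \<gamma> $ n"
    using nz by (simp add: hg_nth_Suc left_diff_distrib)
  \<comment> \<open>Division with remainder in n isolates the multiplier that belongs to the shifted
    series.\<close>
  also have "(\<alpha> + of_nat n) * (\<beta> + of_nat n) / (\<gamma> + of_nat n) - of_nat n =
      \<alpha> - (\<gamma> - \<beta>) * ((\<alpha> + of_nat n) / (\<gamma> + of_nat n))"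
    using \<gamma>[of n] by (simp add: divide_simps) (simp add: algebra_simps)
  also have "\<dots> * hg \<alpha> \<beta> \<gamma> $ n = \<alpha> * hg \<alpha> \<beta> \<gamma> $ n - (\<gamma> - \<beta>) * (\<alpha> / \<gamma> * hg (\<alpha> + 1) \<beta> (\<gamma> + 1) $ n)"
    unfolding eq by (simp add: algebra_simps)
  finally show "((1 - fps_X) * fps_deriv (hg \<alpha> \<beta> \<gamma>)) $ n =
      (fps_const \<alpha> * hg \<alpha> \<beta> \<gamma> + fps_const (- \<alpha> * (\<gamma> - \<beta>) / \<gamma>) * hg (\<alpha> + 1) \<beta> (\<gamma> + 1)) $ n"
    by simp
qed

text \<open>At \<open>Suc k\<close> every term is a rational multiple of coefficient k of the fully
  shifted series. In Model I this expresses D' through D and N.\<close>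

lemma hg_deriv_shift_all:
  "(1 - fps_X) * fps_deriv (hg \<alpha> \<beta> \<gamma>) = fps_const (\<alpha> * \<beta> / \<gamma>) * hg \<alpha> \<beta> \<gamma> +
     fps_const (- \<alpha> * \<beta> * (\<gamma> - \<alpha>) * (\<gamma> - \<beta>) / (\<gamma>\<^sup>2 * (\<gamma> + 1))) * fps_X * hg (\<alpha> + 1) (\<beta> + 1) (\<gamma> + 2)"
proof (rule fps_ext)
  fix n
  show "((1 - fps_X) * fps_deriv (hg \<alpha> \<beta> \<gamma>)) $ n = (fps_const (\<alpha> * \<beta> / \<gamma>) * hg \<alpha> \<beta> \<gamma> +
     fps_const (- \<alpha> * \<beta> * (\<gamma> - \<alpha>) * (\<gamma> - \<beta>) / (\<gamma>\<^sup>2 * (\<gamma> + 1))) * fps_X * hg (\<alpha> + 1) (\<beta> + 1) (\<gamma> + 2)) $ n"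
  proof (cases n)
    case 0
    then show ?thesis by (simp add: hg_nth left_diff_distrib mult.assoc)
  next
    case (Suc k)
    define H where "H = hg (\<alpha> + 1) (\<beta> + 1) (\<gamma> + 2) $ k"
    have nz: "1 + of_nat k \<noteq> (0::'a)" "2 + of_nat k \<noteq> (0::'a)"
      using of_nat_neq_0[of k, where 'a = 'a] of_nat_neq_0[of "Suc k", where 'a = 'a] by simp_all
    have D1: "hg \<alpha> \<beta> \<gamma> $ Suc k = \<alpha> * \<beta> * (\<gamma> + 1 + of_nat k) / (\<gamma> * (\<gamma> + 1) * (1 + of_nat k)) * H"
      using \<gamma>_Suc[of k] by (simp add: H_def hg_nth pochhammer_\<gamma>_Suc pochhammer_rec[of \<alpha>]
          pochhammer_rec[of \<beta>] divide_simps)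
    have D2: "hg \<alpha> \<beta> \<gamma> $ Suc (Suc k) =
        (\<alpha> + 1 + of_nat k) * (\<beta> + 1 + of_nat k) / ((\<gamma> + 1 + of_nat k) * (2 + of_nat k)) * hg \<alpha> \<beta> \<gamma> $ Suc k"
      using hg_nth_Suc[of "Suc k"] by (simp add: add_ac)
    have "((1 - fps_X) * fps_deriv (hg \<alpha> \<beta> \<gamma>)) $ n =
        (2 + of_nat k) * hg \<alpha> \<beta> \<gamma> $ Suc (Suc k) - (1 + of_nat k) * hg \<alpha> \<beta> \<gamma> $ Suc k"
      by (simp add: Suc left_diff_distrib)
    also have "\<dots> = \<alpha> * \<beta> / (\<gamma> * (\<gamma> + 1)) * H *
        ((\<alpha> + 1 + of_nat k) * (\<beta> + 1 + of_nat k) / (1 + of_nat k) - (\<gamma> + 1 + of_nat k))"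
      unfolding D2 D1 using nz \<gamma>_Suc[of k] \<gamma>_0 \<gamma>_1 by (simp add: divide_simps) (simp add: algebra_simps)
    \<comment> \<open>The split separates the multiple of (\<gamma> + 1 + k) / (1 + k), which by
      \<open>D1\<close> is the share of the unshifted series, from a constant, the share of
      \<open>H\<close>.\<close>
    also have "(\<alpha> + 1 + of_nat k) * (\<beta> + 1 + of_nat k) / (1 + of_nat k) - (\<gamma> + 1 + of_nat k) =
        \<alpha> * \<beta> * (\<gamma> + 1 + of_nat k) / (\<gamma> * (1 + of_nat k)) - (\<gamma> - \<alpha>) * (\<gamma> - \<beta>) / \<gamma>"
      using nz \<gamma>_0 by (simp add: divide_simps) (simp add: algebra_simps)
    also have "\<alpha> * \<beta> / (\<gamma> * (\<gamma> + 1)) * H *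
        (\<alpha> * \<beta> * (\<gamma> + 1 + of_nat k) / (\<gamma> * (1 + of_nat k)) - (\<gamma> - \<alpha>) * (\<gamma> - \<beta>) / \<gamma>) =
        \<alpha> * \<beta> / \<gamma> * hg \<alpha> \<beta> \<gamma> $ Suc k + (- \<alpha> * \<beta> * (\<gamma> - \<alpha>) * (\<gamma> - \<beta>) / (\<gamma>\<^sup>2 * (\<gamma> + 1))) * H"
      unfolding D1 using nz \<gamma>_0 \<gamma>_1
      by (simp add: divide_simps power2_eq_square) (simp add: algebra_simps)
    finally show ?thesis
      by (simp add: Suc H_def mult.assoc)
  qed
qed

end

section \<open>The Stieltjes transform as a ratio\<close>

text \<open>Every unknown on the right carries a factor X, so coefficient j of all the
  \<open>V n\<close> together is determined by the coefficients below j: 1 - X J is invertible over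
  formal power series.\<close>

lemma fps_tridiag_unique:
  fixes V U S :: "nat \<Rightarrow> complex fps"
  assumes V: "\<And>n. V n = S n + fps_X * (p n * V n + (case n of 0 \<Rightarrow> 0 | Suc m \<Rightarrow> q m * V m) + q n * V (Suc n))"
    and U: "\<And>n. U n = S n + fps_X * (p n * U n + (case n of 0 \<Rightarrow> 0 | Suc m \<Rightarrow> q m * U m) + q n * U (Suc n))"
  shows "V n = U n"
proof -
  have "\<forall>n. \<forall>i<j. V n $ i = U n $ i" for j
  proof (induction j)
    case (Suc j)
    have mult: "(r * V m) $ i = (r * U m) $ i" if "i < j" for r m i
      unfolding fps_mult_nth using Suc that by (intro sum.cong) auto
    have "V n $ j = U n $ j" for n
    proof (cases j)
      case 0
      then show ?thesis
        by (subst V, subst U) simp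
    next
      case (Suc i)
      then show ?thesis
        by (subst V, subst U) (simp add: mult split: nat.split)
    qed
    with Suc show ?case
      by (auto simp: less_Suc_eq)
  qed simp
  then show ?thesis
    by (auto simp: fps_eq_iff)
qed

text \<open>The generating functions of the entries (0, n) of the powers of J solve (1 - X J) V =
  \<delta>, with \<delta> the unit vector at index 0. Multiplied by \<open>D\<close> they satisfy
  the same system as \<open>U\<close>.\<close>

lemma moment_fps_mult:
  fixes U :: "nat \<Rightarrow> complex fps"
  assumes "\<And>n. U n = (if n = 0 then D else 0) + fps_X * (fps_const (of_real (d n)) * U n +
    (case n of 0 \<Rightarrow> 0 | Suc m \<Rightarrow> fps_const (of_real (e m)) * U m) + fps_const (of_real (e n)) * U (Suc n))"
  shows "Abs_fps (\<lambda>k. of_real (mat_power (sym_tridiag d e) k 0 0)) * D = U 0"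
proof -
  define V where "V n = Abs_fps (\<lambda>k. complex_of_real (mat_power (sym_tridiag d e) k 0 n))" for n
  have V: "V n = (if n = 0 then 1 else 0) + fps_X * (fps_const (of_real (d n)) * V n +
      (case n of 0 \<Rightarrow> 0 | Suc m \<Rightarrow> fps_const (of_real (e m)) * V m) + fps_const (of_real (e n)) * V (Suc n))" for n
  proof (rule fps_ext)
    fix k
    show "V n $ k = ((if n = 0 then 1 else 0) + fps_X * (fps_const (of_real (d n)) * V n +
      (case n of 0 \<Rightarrow> 0 | Suc m \<Rightarrow> fps_const (of_real (e m)) * V m) + fps_const (of_real (e n)) * V (Suc n))) $ k"
      by (cases k; cases n)
         (auto simp: V_def mat_power_sym_tridiag tridiag_op_def simp del: mat_power.simps(2))
  qed
  have "V 0 * D = U 0"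
  proof (rule fps_tridiag_unique[where V = "\<lambda>n. V n * D" and U = U and S = "\<lambda>n. if n = 0 then D else 0"
        and p = "\<lambda>n. fps_const (of_real (d n))" and q = "\<lambda>n. fps_const (of_real (e n))"])
    show "V n * D = (if n = 0 then D else 0) + fps_X * (fps_const (of_real (d n)) * (V n * D) +
      (case n of 0 \<Rightarrow> 0 | Suc m \<Rightarrow> fps_const (of_real (e m)) * (V m * D)) +
      fps_const (of_real (e n)) * (V (Suc n) * D))" for n
      by (subst V) (auto simp: algebra_simps split: nat.split)
  qed (rule assms)
  then show ?thesis by (simp add: V_def)
qed

text \<open>The vector with entries \<open>e\<^sub>0 \<cdots> e\<^bsub>n-1\<^esub> X\<^sup>n F\<^sub>n\<close> solves \<open>(1 - X J) U = D \<delta>\<^sub>0\<close>.\<close>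

lemma moment_fps_mult_three_term:
  fixes F :: "nat \<Rightarrow> complex fps"
  assumes D: "D = (1 - fps_const (of_real (d 0)) * fps_X) * F 0 -
      fps_const (of_real (e 0 ^ 2)) * fps_X ^ 2 * F 1"
    and F: "\<And>n. F n = (1 - fps_const (of_real (d (Suc n))) * fps_X) * F (Suc n) -
      fps_const (of_real (e (Suc n) ^ 2)) * fps_X ^ 2 * F (Suc (Suc n))"
  shows "Abs_fps (\<lambda>k. of_real (mat_power (sym_tridiag d e) k 0 0)) * D = F 0"
proof -
  define U where "U n = fps_const (of_real (\<Prod>i<n. e i)) * fps_X ^ n * F n" for n
  have "Abs_fps (\<lambda>k. of_real (mat_power (sym_tridiag d e) k 0 0)) * D = U 0"
  proof (rule moment_fps_mult)
    fix n
    show "U n = (if n = 0 then D else 0) + fps_X * (fps_const (of_real (d n)) * U n +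
      (case n of 0 \<Rightarrow> 0 | Suc m \<Rightarrow> fps_const (of_real (e m)) * U m) + fps_const (of_real (e n)) * U (Suc n))"
    proof (cases n)
      case 0
      define E where "E = fps_const (complex_of_real (e 0))"
      have E2: "fps_const (complex_of_real (e 0 ^ 2)) = E * E"
        by (simp add: E_def power2_eq_square)
      have "F 0 = D + fps_X * (fps_const (of_real (d 0)) * F 0 + E * (E * fps_X * F 1))"
        unfolding D E2 by (simp add: power2_eq_square algebra_simps)
      then show ?thesis
        by (simp add: 0 U_def E_def)
    next
      case (Suc m)
      define c where "c = fps_const (complex_of_real (\<Prod>i<Suc m. e i))"
      have Um: "fps_const (of_real (e m)) * U m = c * fps_X ^ m * F m"
        by (simp add: U_def c_def algebra_simps flip: fps_const_mult)
      have Un: "U (Suc m) = c * fps_X ^ Suc m * F (Suc m)"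
        by (simp add: U_def c_def)
      have US: "fps_const (of_real (e (Suc m))) * U (Suc (Suc m)) =
          c * fps_X ^ Suc (Suc m) * (fps_const (of_real (e (Suc m) ^ 2)) * F (Suc (Suc m)))"
        by (simp add: U_def c_def power2_eq_square algebra_simps flip: fps_const_mult)
      have "fps_X * (fps_const (of_real (d (Suc m))) * U (Suc m) + fps_const (of_real (e m)) * U m +
          fps_const (of_real (e (Suc m))) * U (Suc (Suc m))) =
          c * fps_X ^ Suc m * (fps_const (of_real (d (Suc m))) * fps_X * F (Suc m) + F m +
            fps_const (of_real (e (Suc m) ^ 2)) * fps_X ^ 2 * F (Suc (Suc m)))"
        unfolding Um Un US by (simp add: power2_eq_square algebra_simps)
      also have "\<dots> = U (Suc m)"
        unfolding Un F[of m] by (simp add: algebra_simps)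
      finally show ?thesis
        by (simp add: Suc)
    qed
  qed
  then show ?thesis by (simp add: U_def)
qed

text \<open>The analytic half of the argument, for all models at once: \<open>ratio\<close> is the
  identity of formal series, and \<open>ode\<close> is the contiguous relation for D'. Its leading
  coefficient \<open>P\<close> will be 1 - w or w, whose zeros are real.\<close>

lemma (in bounded_jacobi) stieltjes_spectral_measure:
  fixes D N P A Q :: "complex \<Rightarrow> complex"
  assumes holo: "D holomorphic_on cut_plane" "N holomorphic_on cut_plane"
      "P holomorphic_on UNIV" "A holomorphic_on UNIV" "Q holomorphic_on UNIV"
    and fps: "D has_fps_expansion Df" "N has_fps_expansion Nf" "P has_fps_expansion Pf"
      "A has_fps_expansion Af" "Q has_fps_expansion Qf"
    and D0: "Df $ 0 = 1"
    and ratio: "Abs_fps (\<lambda>k. of_real (mat_power (sym_tridiag d e) k 0 0)) * Df = Nf"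
    and ode: "Pf * fps_deriv Df = Af * Df + Qf * Nf"
    and P_nz: "\<And>w. Im w \<noteq> 0 \<Longrightarrow> P w \<noteq> 0"
    and z: "z \<notin> \<real>"
  shows "stieltjes (spectral_measure (sym_tridiag d e)) z = - (N (1 / z) / (z * D (1 / z)))"
proof -
  define M where "M = spectral_measure (sym_tridiag d e)"
  define K where "K = {- (3 * B)..3 * B}"
  define T where "T = binomial_integral 1 K M"
  \<comment> \<open>Both half-planes, joined through a disc around 0 so that the expansion at 0
    determines functions on all of \<open>S\<close>. Radius at most 1 keeps the disc in the cut
    plane; radius at most 1 / (3 B) keeps 1 - w x off the branch cut for x in
    \<open>K\<close>.\<close>
  define S where "S = {w. Im w \<noteq> 0} \<union> ball (0::complex) (min 1 (1 / (3 * B)))"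
  define w where "w = 1 / z"
  have supp: "AE x in M. x \<in> K"
    using spectral_measure(2) unfolding M_def by eventually_elim (auto simp: K_def abs_le_iff)
  have "is_spectral_measure (sym_tridiag d e) M"
    unfolding M_def by (rule spectral_measure(1))
  then have "prob_space M" and sets [measurable_cong]: "sets M = sets borel"
    and moments: "\<And>k. (\<integral>x. x ^ k \<partial>M) = mat_power (sym_tridiag d e) k 0 0"
    by (auto simp: is_spectral_measure_def)
  interpret prob_space M by fact
  have fin: "finite_measure M"
    by unfold_locales
  have K: "compact K" "K \<in> sets M"
    by (simp_all add: K_def sets)
  have set_integral: "(LINT x:K|M. f x) = (\<integral>x. f x \<partial>M)"
    if [measurable]: "f \<in> borel_measurable M" for f :: "real \<Rightarrow> 'b::{banach, second_countable_topology}"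
    unfolding set_lebesgue_integral_def
  proof (rule integral_cong_AE)
    show "AE x in M. indicator K x *\<^sub>R f x = f x"
      using supp by eventually_elim simp
  qed (use K in measurable)
  have "w \<noteq> 0" and Im_w: "Im w \<noteq> 0"
    using z by (auto simp: w_def complex_is_Real_iff Im_divide power2_eq_square)
  have z_eq: "z = 1 / w"
    by (simp add: w_def)

  have S_open: "open S"
  proof -
    have "open {w. Im w \<noteq> 0}"
      by (intro open_Collect_neq continuous_intros)
    then show ?thesis by (auto simp: S_def)
  qed
  have "0 \<in> S"
    using B_pos by (simp add: S_def)
  have S_connected: "connected S"
  proof (rule starlike_imp_connected)
    show "starlike S"
      unfolding starlike_def
    proof (intro bexI[OF _ \<open>0 \<in> S\<close>] ballI subsetI)
      fix u v assume u: "u \<in> S" and "v \<in> closed_segment 0 u"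
      then obtain t where t: "0 \<le> t" "t \<le> 1" "v = t *\<^sub>R u"
        by (auto simp: closed_segment_def)
      show "v \<in> S"
      proof (cases "Im u = 0 \<or> t = 0")
        case True
        have "norm v \<le> norm u"
          using t mult_right_mono[of t 1 "norm u"] by simp
        then show ?thesis
          using True u t B_pos by (auto simp: S_def)
      next
        case False
        with t show ?thesis by (simp add: S_def)
      qed
    qed
  qed
  have S_cut: "S \<subseteq> cut_plane"
    using ball_subset_cut_plane by (auto simp: S_def cut_plane_def)
  have T_holo: "T holomorphic_on S"
    unfolding T_def
  proof (rule binomial_integral_holomorphic[OF fin sets K(1) S_open])
    fix u x assume u: "u \<in> S" and x: "x \<in> K"
    show "1 - u * complex_of_real x \<notin> \<real>\<^sub>\<le>\<^sub>0"
    proof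
      assume "1 - u * complex_of_real x \<in> \<real>\<^sub>\<le>\<^sub>0"
      then have *: "1 \<le> Re u * x" "Im u * x = 0"
        by (auto simp: complex_nonpos_Reals_iff)
      then have "Im u = 0" by auto
      with u have "norm u < 1 / (3 * B)"
        by (simp add: S_def)
      moreover have "1 \<le> norm u * (3 * B)"
      proof -
        have "Re u * x \<le> \<bar>Re u\<bar> * \<bar>x\<bar>"
          by (metis abs_ge_self abs_mult)
        also have "\<dots> \<le> norm u * (3 * B)"
          using x by (intro mult_mono abs_Re_le_cmod) (auto simp: K_def)
        finally show ?thesis using * by linarith
      qed
      ultimately show False
        using B_pos by (simp add: field_simps)
    qed
  qed
  have "T has_fps_expansion Abs_fps (\<lambda>k. pochhammer 1 k / fact k * of_real (LINT x:K|M. x ^ k))"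
    unfolding T_def
    by (rule binomial_integral_has_fps_expansion[OF fin sets K(1), where R = "3 * B"])
       (use B_pos in \<open>auto simp: K_def\<close>)
  also have "Abs_fps (\<lambda>k. pochhammer 1 k / fact k * of_real (LINT x:K|M. x ^ k)) =
      Abs_fps (\<lambda>k. complex_of_real (mat_power (sym_tridiag d e) k 0 0))"
    by (simp add: fps_eq_iff set_integral moments flip: pochhammer_fact)
  finally have T_fps: "T has_fps_expansion Abs_fps (\<lambda>k. complex_of_real (mat_power (sym_tridiag d e) k 0 0))" .

  have TD: "T u * D u = N u" if "u \<in> S" for u
  proof -
    have "(\<lambda>u. T u * D u - N u) has_fps_expansion
        Abs_fps (\<lambda>k. of_real (mat_power (sym_tridiag d e) k 0 0)) * Df - Nf"
      by (intro fps_expansion_intros T_fps fps)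
    then have "(\<lambda>u. T u * D u - N u) has_fps_expansion 0"
      by (simp add: ratio)
    moreover have "(\<lambda>u. T u * D u - N u) holomorphic_on S"
      by (intro holomorphic_intros T_holo holomorphic_on_subset[OF _ S_cut] holo)
    ultimately have "T u * D u - N u = 0"
      by (rule has_fps_expansion_0_analytic_continuation[OF _ _ S_open S_connected \<open>0 \<in> S\<close> that])
    then show ?thesis by simp
  qed

  have D_ode: "P u * deriv D u = A u * D u + Q u * N u" if "u \<in> cut_plane" for u
  proof -
    let ?f = "\<lambda>u. P u * deriv D u - (A u * D u + Q u * N u)"
    have "?f has_fps_expansion Pf * fps_deriv Df - (Af * Df + Qf * Nf)"
      by (intro fps_expansion_intros fps)
    then have "?f has_fps_expansion 0"
      by (simp add: ode)
    moreover have "?f holomorphic_on cut_plane"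
      by (intro holomorphic_intros holo holomorphic_on_subset[OF holo(3)] holomorphic_on_subset[OF holo(4)]
          holomorphic_on_subset[OF holo(5)] open_cut_plane) auto
    ultimately have "?f u = 0"
      by (rule has_fps_expansion_0_analytic_continuation[OF _ _ open_cut_plane
            starlike_imp_connected[OF starlike_cut_plane] _ that])
         (simp add: cut_plane_def)
    then show ?thesis by simp
  qed

  \<comment> \<open>\<open>N = T D\<close> turns the contiguous relation into \<open>D' = h D\<close> with \<open>h\<close> holomorphic off the real axis.\<close>
  have D_nz: "D w \<noteq> 0"
  proof
    assume Dw: "D w = 0"
    \<comment> \<open>The half-plane containing \<open>w\<close>: convexity gives \<open>h\<close> a
      primitive, and the real zeros of \<open>P\<close> are left out, among them the point 0 of
      \<open>S\<close> in Model III.\<close>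
    obtain H where H: "convex H" "open H" "w \<in> H" "H \<subseteq> {u. Im u \<noteq> 0}"
    proof (cases "0 < Im w")
      case True
      then show thesis
        by (intro that[of "{u. 0 < Im u}"]) (auto simp: convex_halfspace_Im_gt open_halfspace_Im_gt)
    next
      case False
      with Im_w show thesis
        by (intro that[of "{u. Im u < 0}"]) (auto simp: convex_halfspace_Im_lt open_halfspace_Im_lt)
    qed
    have H_S: "H \<subseteq> S" and H_cut: "H \<subseteq> cut_plane"
      using H(4) S_cut by (auto simp: S_def)
    define h where "h u = (A u + Q u * T u) / P u" for u
    have "h holomorphic_on H"
      unfolding h_def
      by (intro holomorphic_intros holomorphic_on_subset[OF holo(3)] holomorphic_on_subset[OF holo(4)]
          holomorphic_on_subset[OF holo(5)] holomorphic_on_subset[OF T_holo] H_S)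
         (use P_nz H(4) in auto)
    then obtain g where g: "\<And>u. u \<in> H \<Longrightarrow> (g has_field_derivative h u) (at u within H)"
      using holomorphic_convex_primitive'[OF H(1,2)] by blast
    have D_deriv: "(D has_field_derivative h u * D u) (at u within H)" if "u \<in> H" for u
    proof -
      have "u \<in> S" "u \<in> cut_plane" "P u \<noteq> 0"
        using that H_S H_cut H(4) P_nz by auto
      then have "deriv D u = h u * D u"
        using D_ode[of u] TD[of u] by (simp add: h_def field_simps)
      moreover have "(D has_field_derivative deriv D u) (at u)"
        by (rule holomorphic_derivI[OF holo(1) open_cut_plane \<open>u \<in> cut_plane\<close>])
      ultimately show ?thesis
        by (metis DERIV_subset subset_UNIV)
    qed
    \<comment> \<open>exp (- g) is the integrating factor of D' = h D. The product is constant, and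
      the zero at \<open>w\<close> makes the constant 0.\<close>
    have "((\<lambda>u. D u * exp (- g u)) has_field_derivative 0) (at u within H)" if "u \<in> H" for u
      by (rule derivative_eq_intros D_deriv g that refl | simp)+
    then have "\<exists>c. \<forall>u\<in>H. D u * exp (- g u) = c"
      by (intro has_field_derivative_zero_constant H(1))
    then obtain c where c: "\<And>u. u \<in> H \<Longrightarrow> D u * exp (- g u) = c"
      by blast
    then have D_H: "D u = 0" if "u \<in> H" for u
      using Dw c[OF H(3)] c[OF that] by simp
    \<comment> \<open>Vanishing on the open set \<open>H\<close> spreads over the connected cut
      plane and contradicts the constant term 1 at the origin.\<close>
    have "D 0 = 0"
    proof (rule analytic_continuation_open[of H cut_plane D "\<lambda>_. 0"])
      show "H \<noteq> {}"
        using H(3) by blast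
      show "connected cut_plane"
        by (rule starlike_imp_connected[OF starlike_cut_plane])
      show "0 \<in> cut_plane"
        by (simp add: cut_plane_def)
    qed (fact H(2) open_cut_plane H_cut holo(1) holomorphic_on_const D_H)+
    moreover have "D 0 = Df $ 0"
      by (rule has_fps_expansion_imp_0_eq_fps_nth_0[OF fps(1)])
    ultimately show False
      using D0 by simp
  qed

  have "stieltjes M z = (LINT x:K|M. 1 / (complex_of_real x - z))"
    unfolding stieltjes_def by (rule set_integral[symmetric]) measurable
  \<comment> \<open>With z = 1 / w, 1 / (x - z) = - w / (1 - w x); the power -1 matches
    \<open>binomial_integral\<close> with exponent parameter 1.\<close>
  also have "\<dots> = (LINT x:K|M. - w * (1 - w * complex_of_real x) powr (- 1))"
  proof (rule set_lebesgue_integral_cong[OF K(2)], intro allI impI)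
    fix x
    have "1 - w * complex_of_real x \<noteq> 0"
    proof
      assume "1 - w * complex_of_real x = 0"
      then have "Im (w * complex_of_real x) = 0" and "x \<noteq> 0"
        by (auto simp: algebra_simps)
      then show False using Im_w by simp
    qed
    moreover have "complex_of_real x - z \<noteq> 0"
      using z by auto
    ultimately show "1 / (complex_of_real x - z) = - w * (1 - w * complex_of_real x) powr (- 1)"
      using \<open>w \<noteq> 0\<close> by (simp add: powr_minus z_eq field_simps)
  qed
  also have "\<dots> = - w * T w"
    unfolding T_def binomial_integral_def by (rule set_integral_mult_right)
  also have "T w = N w / D w"
    using TD[of w] D_nz Im_w by (simp add: S_def field_simps)
  finally show ?thesis
    by (simp add: M_def w_def)
qed

section \<open>The three models\<close>

lemma bounded_jacobiI:
  assumes "d \<longlonglongrightarrow> x" "e \<longlonglongrightarrow> y"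
  obtains B where "bounded_jacobi d e B"
proof -
  obtain K L where "\<And>n. norm (d n) \<le> K" "\<And>n. norm (e n) \<le> L"
    using convergent_imp_Bseq[of d] convergent_imp_Bseq[of e] assms
    unfolding convergent_def Bseq_def by blast
  then have "bounded_jacobi d e (max 1 (max K L))"
    by unfold_locales (auto simp: le_max_iff_disj)
  then show thesis by (rule that)
qed

lemma jac_lambda_lim: "jac_lambda a b c \<longlonglongrightarrow> 1 / 4"
  unfolding jac_lambda_def by real_asymp

lemma jac_mu_lim: "jac_mu a b c \<longlonglongrightarrow> 1 / 4"
  unfolding jac_mu_def by real_asymp

text \<open>The entries converge and are therefore bounded. The hypotheses start at n = 1 because
  the models differ in the first row, which does not affect limits.\<close>

lemma model_bounded_jacobi:
  assumes "\<And>n. 0 < n \<Longrightarrow> d n = jac_lambda a b c n + jac_mu a b c n"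
    and "\<And>n. 0 < n \<Longrightarrow> e n = sqrt (jac_lambda a b c n * jac_mu a b c (Suc n))"
  obtains B where "bounded_jacobi d e B"
proof (rule bounded_jacobiI)
  have "(\<lambda>n. jac_lambda a b c n + jac_mu a b c n) \<longlonglongrightarrow> 1 / 4 + 1 / 4"
    by (intro tendsto_intros jac_lambda_lim jac_mu_lim)
  then show "d \<longlonglongrightarrow> 1 / 4 + 1 / 4"
    by (rule Lim_transform_eventually) (use eventually_gt_at_top[of 0] in eventually_elim, simp add: assms)
  have "(\<lambda>n. sqrt (jac_lambda a b c n * jac_mu a b c (Suc n))) \<longlonglongrightarrow> sqrt (1 / 4 * (1 / 4))"
    by (intro tendsto_intros jac_lambda_lim LIMSEQ_Suc jac_mu_lim)
  then show "e \<longlonglongrightarrow> sqrt (1 / 4 * (1 / 4))"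
    by (rule Lim_transform_eventually) (use eventually_gt_at_top[of 0] in eventually_elim, simp add: assms)
qed

section \<open>Gauss's recurrences with the coefficients of the models\<close>

context
  fixes a b c :: real
begin

text \<open>\<open>even_fps\<close> and \<open>odd_fps\<close> alternate along the chain of Gauss's
  continued fraction. Each link raises the lower parameter and one upper parameter by one: the
  second from \<open>even_fps n\<close> to \<open>odd_fps n\<close>, the first from there to
  \<open>even_fps (Suc n)\<close>.\<close>

definition even_fps :: "nat \<Rightarrow> complex fps" where
  "even_fps n = hg (of_real (c + real n)) (of_real (c + a + real n)) (of_real (2 * c + a + b + 2 * real n))"

definition odd_fps :: "nat \<Rightarrow> complex fps" where
  "odd_fps n = hg (of_real (c + real n)) (of_real (c + a + 1 + real n)) (of_real (2 * c + a + b + 1 + 2 * real n))"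

lemma of_real_add_of_nat_nonzero:
  assumes "0 < x"
  shows "complex_of_real x + of_nat k \<noteq> 0"
proof
  assume "complex_of_real x + of_nat k = 0"
  then have "Re (complex_of_real x + of_nat k) = 0"
    by simp
  then show False
    using assms by simp
qed

lemma even_fps_rec:
  assumes "0 < 2 * c + a + b + 2 * real n"
  shows "even_fps n = odd_fps n - fps_const (of_real (jac_mu a b c n)) * (fps_X * even_fps (Suc n))"
proof -
  define \<alpha> \<beta> \<gamma> where "\<alpha> = c + real n" and "\<beta> = c + a + real n" and "\<gamma> = 2 * c + a + b + 2 * real n"
  have "0 < \<gamma>"
    using assms by (simp add: \<gamma>_def)
  have coeff: "\<alpha> * (\<gamma> - \<beta>) / (\<gamma> * (\<gamma> + 1)) = jac_mu a b c n"
    using \<open>0 < \<gamma>\<close> by (simp add: jac_mu_def \<alpha>_def \<beta>_def \<gamma>_def field_simps)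
  have "complex_of_real \<alpha> * (of_real \<gamma> - of_real \<beta>) / (of_real \<gamma> * (of_real \<gamma> + 1)) = of_real (jac_mu a b c n)"
    unfolding coeff[symmetric] by simp
  then have "hg (complex_of_real \<alpha>) (of_real \<beta>) (of_real \<gamma>) = hg (of_real \<alpha>) (of_real (\<beta> + 1)) (of_real (\<gamma> + 1)) -
      fps_const (of_real (jac_mu a b c n)) * (fps_X * hg (of_real (\<alpha> + 1)) (of_real (\<beta> + 1)) (of_real (\<gamma> + 2)))"
    using hg_gauss[of "complex_of_real \<gamma>" "of_real \<alpha>" "of_real \<beta>",
        OF of_real_add_of_nat_nonzero[OF \<open>0 < \<gamma>\<close>]] by simp
  moreover have "even_fps n = hg (of_real \<alpha>) (of_real \<beta>) (of_real \<gamma>)"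
    "odd_fps n = hg (of_real \<alpha>) (of_real (\<beta> + 1)) (of_real (\<gamma> + 1))"
    "even_fps (Suc n) = hg (of_real (\<alpha> + 1)) (of_real (\<beta> + 1)) (of_real (\<gamma> + 2))"
    by (simp_all add: even_fps_def odd_fps_def \<alpha>_def \<beta>_def \<gamma>_def algebra_simps)
  ultimately show ?thesis
    by (simp only:)
qed

text \<open>Gauss's relation with the upper parameters exchanged; its coefficient is then
  \<lambda>_n, whereas the unexchanged relation produced \<mu>_n.\<close>

lemma odd_fps_rec:
  assumes "0 < 2 * c + a + b + 1 + 2 * real n"
  shows "odd_fps n = even_fps (Suc n) - fps_const (of_real (jac_lambda a b c n)) * (fps_X * odd_fps (Suc n))"
proof -
  define \<alpha> \<beta> \<gamma> where "\<alpha> = c + a + 1 + real n" and "\<beta> = c + real n" and "\<gamma> = 2 * c + a + b + 1 + 2 * real n"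
  have "0 < \<gamma>"
    using assms by (simp add: \<gamma>_def)
  have coeff: "\<alpha> * (\<gamma> - \<beta>) / (\<gamma> * (\<gamma> + 1)) = jac_lambda a b c n"
    using \<open>0 < \<gamma>\<close> by (simp add: jac_lambda_def \<alpha>_def \<beta>_def \<gamma>_def field_simps)
  have "complex_of_real \<alpha> * (of_real \<gamma> - of_real \<beta>) / (of_real \<gamma> * (of_real \<gamma> + 1)) = of_real (jac_lambda a b c n)"
    unfolding coeff[symmetric] by simp
  then have "hg (complex_of_real \<alpha>) (of_real \<beta>) (of_real \<gamma>) = hg (of_real \<alpha>) (of_real (\<beta> + 1)) (of_real (\<gamma> + 1)) -
      fps_const (of_real (jac_lambda a b c n)) * (fps_X * hg (of_real (\<alpha> + 1)) (of_real (\<beta> + 1)) (of_real (\<gamma> + 2)))"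
    using hg_gauss[of "complex_of_real \<gamma>" "of_real \<alpha>" "of_real \<beta>",
        OF of_real_add_of_nat_nonzero[OF \<open>0 < \<gamma>\<close>]] by simp
  moreover have "odd_fps n = hg (of_real \<beta>) (of_real \<alpha>) (of_real \<gamma>)"
    "even_fps (Suc n) = hg (of_real (\<beta> + 1)) (of_real \<alpha>) (of_real (\<gamma> + 1))"
    "odd_fps (Suc n) = hg (of_real (\<beta> + 1)) (of_real (\<alpha> + 1)) (of_real (\<gamma> + 2))"
    by (simp_all add: even_fps_def odd_fps_def \<alpha>_def \<beta>_def \<gamma>_def algebra_simps)
  ultimately show ?thesis
    by (simp only: hg_commute[of "of_real \<beta>"] hg_commute[of "of_real (\<beta> + 1)"])
qed

text \<open>Eliminating \<open>odd_fps\<close> contracts the continued fraction to its even part,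
  which produces the sums \<lambda>_n + \<mu>_n and the products \<lambda>_n \<mu>_(n+1) of the
  Jacobi matrix.\<close>

lemma even_fps_three_term:
  assumes "0 < 2 * c + a + b + 2 * real n"
  shows "even_fps n = (1 - fps_const (of_real (jac_lambda a b c n + jac_mu a b c n)) * fps_X) * even_fps (Suc n) -
    fps_const (of_real (jac_lambda a b c n * jac_mu a b c (Suc n))) * fps_X ^ 2 * even_fps (Suc (Suc n))"
proof -
  have "even_fps n = even_fps (Suc n) - fps_const (of_real (jac_lambda a b c n)) * (fps_X * odd_fps (Suc n))
      - fps_const (of_real (jac_mu a b c n)) * (fps_X * even_fps (Suc n))"
    using even_fps_rec[of n] odd_fps_rec[of n] assms by simp
  also have "odd_fps (Suc n) = even_fps (Suc n) + fps_const (of_real (jac_mu a b c (Suc n))) * (fps_X * even_fps (Suc (Suc n)))"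
    using even_fps_rec[of "Suc n"] assms by simp
  finally show ?thesis
    by (simp add: power2_eq_square algebra_simps flip: fps_const_mult fps_const_add)
qed

end

section \<open>The ratio formula for an arbitrary first row\<close>

lemma even_fps_1:
  "even_fps a b c 1 = hg (of_real (c + 1)) (of_real (c + a + 1)) (of_real (2 * c + a + b + 2))"
  by (simp add: even_fps_def)

text \<open>The models share all rows after the first, and there the recurrence runs along
  \<open>even_fps\<close> from index 1, the numerator. A model contributes its denominator through
  \<open>first_row\<close> and the matching differential relation through
  \<open>ode\<close>.\<close>

lemma model_stieltjes:
  fixes a b c \<beta> \<gamma> :: real and \<alpha> z :: complex
  assumes pos: "0 < c + a + 1" "0 < c + b + 1"
    and d: "\<And>n. 0 < n \<Longrightarrow> d n = jac_lambda a b c n + jac_mu a b c n"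
    and e: "\<And>n. 0 < n \<Longrightarrow> e n = sqrt (jac_lambda a b c n * jac_mu a b c (Suc n))"
    and jacobi: "jacobi_matrix (sym_tridiag d e)"
    and \<gamma>: "0 < \<beta>" "\<beta> < \<gamma>"
    and first_row: "hg \<alpha> (of_real \<beta>) (of_real \<gamma>) =
      (1 - fps_const (of_real (d 0)) * fps_X) * even_fps a b c 1 -
      fps_const (of_real (e 0 ^ 2)) * fps_X ^ 2 * even_fps a b c 2"
    and holo: "P holomorphic_on UNIV" "Q holomorphic_on UNIV"
    and fps: "P has_fps_expansion Pf" "Q has_fps_expansion Qf"
    and ode: "Pf * fps_deriv (hg \<alpha> (of_real \<beta>) (of_real \<gamma>)) =
      fps_const k * hg \<alpha> (of_real \<beta>) (of_real \<gamma>) + Qf * even_fps a b c 1"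
    and P_nz: "\<And>w. Im w \<noteq> 0 \<Longrightarrow> P w \<noteq> 0"
    and z: "z \<notin> \<real>"
  shows "stieltjes (spectral_measure (sym_tridiag d e)) z =
    - (hypergeo_2F1 (of_real (c + 1)) (of_real (c + a + 1)) (of_real (2 * c + a + b + 2)) (1 / z) /
       (z * hypergeo_2F1 \<alpha> (of_real \<beta>) (of_real \<gamma>) (1 / z)))"
proof -
  obtain B where "bounded_jacobi d e B"
    using model_bounded_jacobi[of d a b c e] d e by blast
  then interpret bounded_jacobi d e B .
  have N: "0 < c + a + 1" "c + a + 1 < 2 * c + a + b + 2"
    using pos by simp_all
  have e2: "e n ^ 2 = jac_lambda a b c n * jac_mu a b c (Suc n)" if "0 < n" for n
  proof -
    \<comment> \<open>\<open>sqrt\<close> of a negative number is negative in HOL, so a positive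
      entry means a positive radicand, and squaring recovers it without a change of sign.\<close>
    have "0 < e n"
      using jacobi by (auto simp: jacobi_matrix_def sym_tridiag_def dest: spec[of _ n])
    then show ?thesis
      using e[OF that] by simp
  qed
  have "Abs_fps (\<lambda>k. of_real (mat_power (sym_tridiag d e) k 0 0)) * hg \<alpha> (of_real \<beta>) (of_real \<gamma>) =
      even_fps a b c (Suc 0)"
  proof (rule moment_fps_mult_three_term[where F = "\<lambda>n. even_fps a b c (Suc n)"])
    show "even_fps a b c (Suc n) = (1 - fps_const (of_real (d (Suc n))) * fps_X) * even_fps a b c (Suc (Suc n)) -
        fps_const (of_real (e (Suc n) ^ 2)) * fps_X ^ 2 * even_fps a b c (Suc (Suc (Suc n)))" for n
      unfolding d[OF zero_less_Suc] e2[OF zero_less_Suc]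
      \<comment> \<open>From row 1 on the recurrence rests on 2 c + a + b + 2 > 0, the sum of the
        two inequalities in \<open>pos\<close>. This covers Model III, where 2 c + a + b may be
        negative.\<close>
      by (rule even_fps_three_term) (use pos in simp)
  qed (use first_row in \<open>simp add: numeral_2_eq_2\<close>)
  then have ratio: "Abs_fps (\<lambda>k. of_real (mat_power (sym_tridiag d e) k 0 0)) * hg \<alpha> (of_real \<beta>) (of_real \<gamma>) =
      even_fps a b c 1"
    by simp
  have D_fps: "hypergeo_2F1 \<alpha> (of_real \<beta>) (of_real \<gamma>) has_fps_expansion hg \<alpha> (of_real \<beta>) (of_real \<gamma>)"
    unfolding hg_def by (rule hypergeo_2F1_has_fps_expansion[OF \<gamma>])
  have N_fps: "hypergeo_2F1 (of_real (c + 1)) (of_real (c + a + 1)) (of_real (2 * c + a + b + 2))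
      has_fps_expansion even_fps a b c 1"
    unfolding even_fps_1 hg_def by (rule hypergeo_2F1_has_fps_expansion[OF N])
  have D0: "hg \<alpha> (of_real \<beta>) (of_real \<gamma>) $ 0 = 1"
    by (simp add: hg_nth)
  show ?thesis
    by (rule stieltjes_spectral_measure[OF hypergeo_2F1_holomorphic[OF \<gamma>] hypergeo_2F1_holomorphic[OF N]
          holo(1) holomorphic_on_const holo(2) D_fps N_fps fps(1) has_fps_expansion_const fps(2)
          D0 ratio ode P_nz z])
qed

section \<open>The first row and the differential relation in each model\<close>

lemma one_minus_props:
  "(\<lambda>w. 1 - w :: complex) holomorphic_on UNIV"
  "(\<lambda>w. 1 - w :: complex) has_fps_expansion 1 - fps_X"
  "Im w \<noteq> 0 \<Longrightarrow> 1 - w \<noteq> 0"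
  by (auto intro!: holomorphic_intros fps_expansion_intros)

text \<open>The first row follows the general pattern, so the recurrence at n = 0 identifies the
  denominator as \<open>even_fps 0\<close>; 2 c + a + b > 0 makes this legitimate.\<close>

lemma stieltjes_J_I:
  assumes model: "model_I a b c" and z: "z \<notin> \<real>"
  shows "stieltjes (spectral_measure (J_I a b c)) z =
    - (hypergeo_2F1 (of_real (c + 1)) (of_real (c + a + 1)) (of_real (2 * c + a + b + 2)) (1 / z) /
       (z * hypergeo_2F1 (of_real c) (of_real (c + a)) (of_real (2 * c + a + b)) (1 / z)))"
  unfolding J_I_def
proof (rule model_stieltjes[where P = "\<lambda>w. 1 - w"])
  have pos: "0 \<le> c" "0 < c + a" "0 < c + b" and jacobi: "jacobi_matrix (J_I a b c)"
    using model by (simp_all add: model_I_def)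
  let ?d = "\<lambda>n. jac_lambda a b c n + jac_mu a b c n"
  let ?e = "\<lambda>n. sqrt (jac_lambda a b c n * jac_mu a b c (Suc n))"
  show "0 < c + a + 1" "0 < c + b + 1" "0 < c + a" "c + a < 2 * c + a + b"
    using pos by simp_all
  show jacobi': "jacobi_matrix (sym_tridiag ?d ?e)"
    using jacobi by (simp add: J_I_def)
  then have "0 < ?e 0"
    by (auto simp: jacobi_matrix_def sym_tridiag_def dest: spec[of _ 0])
  then have e0: "?e 0 ^ 2 = jac_lambda a b c 0 * jac_mu a b c (Suc 0)"
    by simp
  show "hg (of_real c) (of_real (c + a)) (of_real (2 * c + a + b)) =
      (1 - fps_const (of_real (?d 0)) * fps_X) * even_fps a b c 1 -
      fps_const (of_real (?e 0 ^ 2)) * fps_X ^ 2 * even_fps a b c 2"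
    unfolding e0 using even_fps_three_term[of c a b 0] pos by (simp add: even_fps_def numeral_2_eq_2)
  let ?\<alpha> = "complex_of_real c" and ?\<beta> = "complex_of_real (c + a)" and ?\<gamma> = "complex_of_real (2 * c + a + b)"
  let ?k = "- ?\<alpha> * ?\<beta> * (?\<gamma> - ?\<alpha>) * (?\<gamma> - ?\<beta>) / (?\<gamma>\<^sup>2 * (?\<gamma> + 1))"
  show "(\<lambda>w. ?k * w) holomorphic_on UNIV"
    by (intro holomorphic_intros)
  show "(\<lambda>w. ?k * w) has_fps_expansion fps_const ?k * fps_X"
    by (intro fps_expansion_intros)
  show "(1 - fps_X) * fps_deriv (hg ?\<alpha> ?\<beta> ?\<gamma>) =
      fps_const (?\<alpha> * ?\<beta> / ?\<gamma>) * hg ?\<alpha> ?\<beta> ?\<gamma> + fps_const ?k * fps_X * even_fps a b c 1"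
    unfolding even_fps_1 using hg_deriv_shift_all[of ?\<gamma> ?\<alpha> ?\<beta>, OF of_real_add_of_nat_nonzero] pos by simp
  show "(\<lambda>w::complex. 1 - w) holomorphic_on UNIV" "(\<lambda>w::complex. 1 - w) has_fps_expansion 1 - fps_X"
    "Im w \<noteq> 0 \<Longrightarrow> 1 - w \<noteq> 0" for w
    by (fact one_minus_props)+
  show "z \<notin> \<real>" by (rule z)
qed simp_all

text \<open>Removing \<mu>_0 from the first diagonal entry omits the first link of the chain, so the
  denominator is \<open>odd_fps 0\<close>.\<close>

lemma stieltjes_J_II:
  assumes model: "model_II a b c" and z: "z \<notin> \<real>"
  shows "stieltjes (spectral_measure (J_II a b c)) z =
    - (hypergeo_2F1 (of_real (c + 1)) (of_real (c + a + 1)) (of_real (2 * c + a + b + 2)) (1 / z) /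
       (z * hypergeo_2F1 (of_real c) (of_real (c + a + 1)) (of_real (2 * c + a + b + 1)) (1 / z)))"
proof -
  let ?d = "\<lambda>n. if n = 0 then jac_lambda a b c 0 else jac_lambda a b c n + jac_mu a b c n"
  let ?e = "\<lambda>n. sqrt (jac_lambda a b c n * jac_mu a b c (Suc n))"
  have pos: "0 \<le> c" "0 < c + a" "0 < c + b" and jacobi: "jacobi_matrix (J_II a b c)"
    using model by (simp_all add: model_II_def)
  have J: "J_II a b c = sym_tridiag ?d ?e"
    by (auto simp: fun_eq_iff J_II_def J_I_def sym_tridiag_def)
  show ?thesis
    unfolding J
  proof (rule model_stieltjes[where P = "\<lambda>w. 1 - w"])
    show "0 < c + a + 1" "0 < c + b + 1" "0 < c + a + 1" "c + a + 1 < 2 * c + a + b + 1"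
      using pos by simp_all
    show jacobi': "jacobi_matrix (sym_tridiag ?d ?e)"
      using jacobi by (simp add: J)
    then have "0 < ?e 0"
      by (auto simp: jacobi_matrix_def sym_tridiag_def dest: spec[of _ 0])
    then have e0: "?e 0 ^ 2 = jac_lambda a b c 0 * jac_mu a b c (Suc 0)"
      by simp
    have "odd_fps a b c (Suc 0) = even_fps a b c 1 + fps_const (of_real (jac_mu a b c (Suc 0))) * (fps_X * even_fps a b c 2)"
      using even_fps_rec[of c a b "Suc 0"] pos by (simp add: numeral_2_eq_2)
    then show "hg (of_real c) (of_real (c + a + 1)) (of_real (2 * c + a + b + 1)) =
        (1 - fps_const (of_real (?d 0)) * fps_X) * even_fps a b c 1 -
        fps_const (of_real (?e 0 ^ 2)) * fps_X ^ 2 * even_fps a b c 2"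
      unfolding e0 using odd_fps_rec[of c a b 0] pos
      by (simp add: odd_fps_def[of _ _ _ 0] power2_eq_square algebra_simps flip: fps_const_mult)
    let ?\<alpha> = "complex_of_real c" and ?\<beta> = "complex_of_real (c + a + 1)" and ?\<gamma> = "complex_of_real (2 * c + a + b + 1)"
    show "(1 - fps_X) * fps_deriv (hg ?\<alpha> ?\<beta> ?\<gamma>) =
        fps_const ?\<alpha> * hg ?\<alpha> ?\<beta> ?\<gamma> + fps_const (- ?\<alpha> * (?\<gamma> - ?\<beta>) / ?\<gamma>) * even_fps a b c 1"
      unfolding even_fps_1 using hg_deriv_shift_both[of ?\<gamma> ?\<alpha> ?\<beta>, OF of_real_add_of_nat_nonzero] pos
      by (simp add: add.assoc)
    show "(\<lambda>w::complex. - ?\<alpha> * (?\<gamma> - ?\<beta>) / ?\<gamma>) holomorphic_on UNIV"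
      by (rule holomorphic_on_const)
    show "(\<lambda>w::complex. - ?\<alpha> * (?\<gamma> - ?\<beta>) / ?\<gamma>) has_fps_expansion fps_const (- ?\<alpha> * (?\<gamma> - ?\<beta>) / ?\<gamma>)"
      by (rule has_fps_expansion_const)
    show "(\<lambda>w::complex. 1 - w) holomorphic_on UNIV" "(\<lambda>w::complex. 1 - w) has_fps_expansion 1 - fps_X"
      "Im w \<noteq> 0 \<Longrightarrow> 1 - w \<noteq> 0" for w
      by (fact one_minus_props)+
    show "z \<notin> \<real>" by (rule z)
  qed simp_all
qed

text \<open>The coefficient \<beta> / \<gamma> in \<open>hg_shift\<close> is exactly
  \<open>jac_lambda_hat\<close>, so the denominator differs from the numerator in the first upper
  parameter alone. The differential relation is the one with the Euler operator, hence
  \<open>P\<close> is w.\<close>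

lemma stieltjes_J_III:
  assumes model: "model_III a b c" and z: "z \<notin> \<real>"
  shows "stieltjes (spectral_measure (J_III a b c)) z =
    - (hypergeo_2F1 (of_real (c + 1)) (of_real (c + a + 1)) (of_real (2 * c + a + b + 2)) (1 / z) /
       (z * hypergeo_2F1 (of_real c) (of_real (c + a + 1)) (of_real (2 * c + a + b + 2)) (1 / z)))"
  unfolding J_III_def
proof (rule model_stieltjes[where P = "\<lambda>w. w"])
  let ?d = "\<lambda>n. if n = 0 then jac_lambda_hat a b c else jac_lambda a b c n + jac_mu a b c n"
  let ?e = "\<lambda>n. sqrt ((if n = 0 then jac_lambda_hat a b c else jac_lambda a b c n) * jac_mu a b c (Suc n))"
  have pos: "0 < c + 1" "0 < c + a + 1" "0 < c + b + 1" and jacobi: "jacobi_matrix (J_III a b c)"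
    using model by (simp_all add: model_III_def)
  show "0 < c + a + 1" "0 < c + b + 1" "0 < c + a + 1" "c + a + 1 < 2 * c + a + b + 2"
    using pos by simp_all
  show jacobi': "jacobi_matrix (sym_tridiag ?d ?e)"
    using jacobi by (simp add: J_III_def)
  then have "0 < ?e 0"
    by (auto simp: jacobi_matrix_def sym_tridiag_def dest: spec[of _ 0])
  then have e0: "?e 0 ^ 2 = jac_lambda_hat a b c * jac_mu a b c (Suc 0)"
    by simp
  let ?\<alpha> = "complex_of_real c" and ?\<beta> = "complex_of_real (c + a + 1)" and ?\<gamma> = "complex_of_real (2 * c + a + b + 2)"
  have \<gamma>: "?\<gamma> + of_nat n \<noteq> 0" for n
    using pos by (intro of_real_add_of_nat_nonzero) simp
  have "hg ?\<alpha> ?\<beta> ?\<gamma> = even_fps a b c 1 - fps_const (?\<beta> / ?\<gamma>) * (fps_X * odd_fps a b c (Suc 0))"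
    using hg_shift[of ?\<gamma> ?\<alpha> ?\<beta>, OF \<gamma>] by (simp add: even_fps_def odd_fps_def algebra_simps)
  also have "?\<beta> / ?\<gamma> = of_real (jac_lambda_hat a b c)"
    by (simp add: jac_lambda_hat_def)
  also have "odd_fps a b c (Suc 0) = even_fps a b c 1 + fps_const (of_real (jac_mu a b c (Suc 0))) * (fps_X * even_fps a b c 2)"
    using even_fps_rec[of c a b "Suc 0"] pos by (simp add: numeral_2_eq_2)
  finally show "hg ?\<alpha> ?\<beta> ?\<gamma> =
      (1 - fps_const (of_real (?d 0)) * fps_X) * even_fps a b c 1 -
      fps_const (of_real (?e 0 ^ 2)) * fps_X ^ 2 * even_fps a b c 2"
    unfolding e0 by (simp add: power2_eq_square algebra_simps flip: fps_const_mult)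
  show "(\<lambda>w::complex. w) holomorphic_on UNIV"
    by (intro holomorphic_intros)
  show "(\<lambda>w::complex. w) has_fps_expansion fps_X"
    by (intro fps_expansion_intros)
  show "fps_X * fps_deriv (hg ?\<alpha> ?\<beta> ?\<gamma>) =
      fps_const (- ?\<alpha>) * hg ?\<alpha> ?\<beta> ?\<gamma> + fps_const ?\<alpha> * even_fps a b c 1"
    unfolding even_fps_1 using hg_deriv_shift[of ?\<gamma> ?\<alpha> ?\<beta>, OF \<gamma>] by simp
  show "(\<lambda>w::complex. ?\<alpha>) holomorphic_on UNIV"
    by (rule holomorphic_on_const)
  show "(\<lambda>w::complex. ?\<alpha>) has_fps_expansion fps_const ?\<alpha>"
    by (rule has_fps_expansion_const)
  show "Im w \<noteq> 0 \<Longrightarrow> w \<noteq> 0" for w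
    by auto
  show "z \<notin> \<real>" by (rule z)
qed simp_all

theorem theorem4p1:
  fixes a b c :: real and z :: complex
  assumes "z \<notin> \<real>"
  shows "(model_I a b c \<longrightarrow>
      stieltjes (spectral_measure (J_I a b c)) z =
        - (hypergeo_2F1 (of_real (c + 1)) (of_real (c + a + 1)) (of_real (2*c + a + b + 2)) (1 / z) /
           (z * hypergeo_2F1 (of_real c) (of_real (c + a)) (of_real (2*c + a + b)) (1 / z)))) \<and>
    (model_II a b c \<longrightarrow>
      stieltjes (spectral_measure (J_II a b c)) z =
        - (hypergeo_2F1 (of_real (c + 1)) (of_real (c + a + 1)) (of_real (2*c + a + b + 2)) (1 / z) /
           (z * hypergeo_2F1 (of_real c) (of_real (c + a + 1)) (of_real (2*c + a + b + 1)) (1 / z)))) \<and>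
    (model_III a b c \<longrightarrow>
      stieltjes (spectral_measure (J_III a b c)) z =
        - (hypergeo_2F1 (of_real (c + 1)) (of_real (c + a + 1)) (of_real (2*c + a + b + 2)) (1 / z) /
           (z * hypergeo_2F1 (of_real c) (of_real (c + a + 1)) (of_real (2*c + a + b + 2)) (1 / z))))"
  by (intro conjI impI stieltjes_J_I stieltjes_J_II stieltjes_J_III assms)

end
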